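(* There exists a constant $C>0$ such that the following holds. Let $N\ge 200$ be an integer, let $d=N^2$, and let $b\in\ell_2^d$ be such that $G_d(b)$ is an orthonormal basis in $\ell_2^d$. Then, for all positive integers $Q,R\in[1,N/16]$, $$\frac1N\sum_{j=NQ}^{d-1}|b(j)|^2+\frac1N\sum_{k=NR}^{d-1}|\mathcal{F}_d b(k)|^2\ge \frac{C}{QR}.$$
   Context: For $N\in\mathbb{N}$ put $d=N^2$ and $\mathbb{Z}_d=\mathbb{Z}/d\mathbb{Z}$. $\ell_2^d$ is the space of all functions $b:\mathbb{Z}_d\to\mathbb{C}$ with norm $\|b\|_d^2=\frac1N\sum_{j=0}^{d-1}|b(j)|^2$ (and the corresponding inner product $\frac1N\sum_{j=0}^{d-1} a(j)\overline{b(j)}$). The finite Fourier transform is $\mathcal{F}_d(b)(k)=\frac1N\sum_{j=0}^{d-1}b(j)e^{-2\pi i jk/d}$, which is unitary on $\ell_2^d$. Let $N\mathbb{Z}_d$ denote the set $\{Nk:k\in\mathbb{Z}\}$ modulo $d$. The Gabor system generated by $b\in\ell_2^d$ is $$G_d(b)=\{e^{2\pi i \ell j/d}\,b(j-k)\}_{(k,\ell)\in (N\mathbb{Z}_d)^2},$$ where each element is viewed as a function of $j\in\mathbb{Z}_d$. *)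

theory Defs
  imports Complex_Main
begin

text \<open>
  Throughout \<open>d = N\<^sup>2\<close>. A function on \<open>\<int>/d\<int>\<close> is represented by a \<open>d\<close>-periodic function on
  the integers, so that \<open>b (j - k)\<close> needs no explicit reduction modulo \<open>d\<close>.
\<close>

definition ell2 :: "nat \<Rightarrow> (int \<Rightarrow> complex) set" where
  "ell2 N = {b. \<forall>j. b (j + int (N\<^sup>2)) = b j}"

definition ell2_inner :: "nat \<Rightarrow> (int \<Rightarrow> complex) \<Rightarrow> (int \<Rightarrow> complex) \<Rightarrow> complex" where
  "ell2_inner N a b = 1 / of_nat N * (\<Sum>j = 0..int (N\<^sup>2) - 1. a j * cnj (b j))"

definition fourier :: "nat \<Rightarrow> (int \<Rightarrow> complex) \<Rightarrow> int \<Rightarrow> complex" where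
  "fourier N b k = 1 / of_nat N *
     (\<Sum>j = 0..int (N\<^sup>2) - 1. b j * exp (- 2 * pi * \<i> * of_int j * of_int k / of_nat (N\<^sup>2)))"

text \<open>\<open>N\<int>\<^sub>d\<close>, each class being given by its representative in \<open>{0..<d}\<close>.\<close>

definition NZd :: "nat \<Rightarrow> int set" where
  "NZd N = {(int N * k) mod int (N\<^sup>2) | k. True}"

definition gabor :: "nat \<Rightarrow> (int \<Rightarrow> complex) \<Rightarrow> int \<times> int \<Rightarrow> int \<Rightarrow> complex" where
  "gabor N b = (\<lambda>(k, l) j. exp (2 * pi * \<i> * of_int l * of_int j / of_nat (N\<^sup>2)) * b (j - k))"

text \<open>
  Orthonormal bases are taken as indexed families. The index set is meant to be finite, since the
  space has finite dimension.
\<close>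

definition orthonormal_basis ::
    "nat \<Rightarrow> 'i set \<Rightarrow> ('i \<Rightarrow> int \<Rightarrow> complex) \<Rightarrow> bool" where
  "orthonormal_basis N I g \<longleftrightarrow>
     finite I \<and> g ` I \<subseteq> ell2 N \<and>
     (\<forall>s\<in>I. \<forall>t\<in>I. ell2_inner N (g s) (g t) = (if s = t then 1 else 0)) \<and>
     (\<forall>a\<in>ell2 N. \<exists>c. \<forall>j. a j = (\<Sum>s\<in>I. c s * g s j))"

end

theory Submission
  imports Defs "HOL-Analysis.Analysis"
begin

text \<open>
  The Gabor system of \<open>b\<close> is orthonormal only if the finite Zak transform \<open>Z\<close> of \<open>b\<close> is unimodular.
  By quasi-periodicity \<open>Z\<close> is then a section of a line bundle of degree one over a discrete torus,
  so it cannot vary slowly along both directions of a grid. A smooth low-pass filter at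
  frequency \<open>N R\<close> gives a function whose Zak transform varies slowly at scale \<open>N / R\<close> in the
  first variable, and a smooth cutoff at time \<open>N Q\<close> one whose Zak transform varies slowly at
  scale \<open>N / Q\<close> in the second. Hence each translate of a grid with this mesh contains a point
  where \<open>Z\<close> is far from one of the two smoothed transforms. Averaging over the translates, the
  \<open>L\<^sup>2\<close> errors of the two smoothings, which are at most the two tails, add up to at least a
  constant times \<open>1 / (Q R)\<close>.
\<close>

section \<open>Characters and finite Fourier sums\<close>

lemma pi_bounds: "157/50 \<le> pi" "pi \<le> 16/5"
  using pi_approx by simp_all

lemma mult_cnj_eq_norm_sq: "z * cnj z = (of_real (cmod z))\<^sup>2"
  by (metis complex_norm_square of_real_power)

definition ee :: "real \<Rightarrow> complex" where
  "ee x = cis (2 * pi * x)"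

lemma ee_add: "ee (x + y) = ee x * ee y"
  by (simp add: ee_def cis_mult distrib_left)

lemma ee_0 [simp]: "ee 0 = 1"
  by (simp add: ee_def)

lemma norm_ee [simp]: "cmod (ee x) = 1"
  by (simp add: ee_def)

lemma ee_nonzero [simp]: "ee x \<noteq> 0"
  by (simp add: ee_def)

lemma cnj_ee: "cnj (ee x) = ee (- x)"
  by (simp add: ee_def cis_cnj)

lemma ee_of_int [simp]: "ee (of_int k) = 1"
  by (simp add: ee_def)

lemma ee_add_int [simp]: "ee (x + of_int k) = ee x"
  by (simp add: ee_add)

lemma ee_mult_int:
  "ee (of_int a / of_int n) * ee (of_int b / of_int n) = ee (of_int (a + b) / of_int n)"
  by (simp add: ee_add add_divide_distrib)

lemma ee_mult_cnj_int:
  "ee (of_int a / of_int n) * cnj (ee (of_int b / of_int n)) = ee (of_int (a - b) / of_int n)"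
  by (simp add: cnj_ee ee_add[symmetric] diff_divide_distrib)

lemma ee_eq_1_imp_Ints:
  assumes "ee x = 1"
  shows "x \<in> \<int>"
proof -
  obtain n :: int where "2 * pi * x = of_int (2 * n) * pi"
    using assms unfolding ee_def cis_conv_exp exp_eq_1 by auto
  then have "x = of_int n"
    by simp
  then show ?thesis
    by simp
qed

lemma norm_ee_diff_1_le: "cmod (ee x - 1) \<le> 2 * pi * \<bar>x\<bar>"
proof -
  have "cmod (ee x - 1) = 2 * \<bar>sin (pi * x)\<bar>"
    using dist_exp_i_1[of "2 * pi * x"] by (simp add: ee_def cis_conv_exp)
  also have "\<dots> \<le> 2 * \<bar>pi * x\<bar>"
    using abs_sin_x_le_abs_x[of "pi * x"] by linarith
  finally show ?thesis
    by (simp add: abs_mult)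
qed

section \<open>Sums over full periods and residue classes\<close>

lemma periodic_mod:
  fixes f :: "int \<Rightarrow> 'a"
  assumes per: "\<And>j. f (j + n) = f j"
  shows "f (j mod n) = f j"
proof -
  have "f (j + i * n) = f j" for i j
  proof (induction i rule: int_induct[of _ 0])
    case (step1 i)
    then show ?case
      using per[of "j + i * n"] by (simp add: algebra_simps)
  next
    case (step2 i)
    then show ?case
      using per[of "j + (i - 1) * n"] by (simp add: algebra_simps)
  qed simp
  from this[of "j mod n" "j div n"] show ?thesis
    by (simp add: add.commute)
qed

lemma sum_periodic_shift:
  fixes f :: "int \<Rightarrow> 'a::comm_monoid_add"
  assumes "n > 0" and per: "\<And>j. f (j + n) = f j"
  shows "(\<Sum>j\<in>{0..<n}. f (j + k)) = (\<Sum>j\<in>{0..<n}. f j)"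
proof -
  have "bij_betw (\<lambda>j. (j + k) mod n) {0..<n} {0..<n}"
  proof (rule bij_betw_byWitness[where f' = "\<lambda>j. (j - k) mod n"])
    show "\<forall>a\<in>{0..<n}. ((a + k) mod n - k) mod n = a"
      using assms(1) by (simp add: mod_diff_left_eq)
    show "\<forall>a\<in>{0..<n}. ((a - k) mod n + k) mod n = a"
      using assms(1) by (simp add: mod_add_left_eq)
  qed (use assms(1) in auto)
  then have "(\<Sum>j\<in>{0..<n}. f ((j + k) mod n)) = (\<Sum>j\<in>{0..<n}. f j)"
    by (rule sum.reindex_bij_betw)
  then show ?thesis
    by (simp add: periodic_mod[where f = f, OF per])
qed

lemma sum_periodic_reflect:
  fixes f :: "int \<Rightarrow> 'a::comm_monoid_add"
  assumes "n > 0" and per: "\<And>j. f (j + n) = f j"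
  shows "(\<Sum>j\<in>{0..<n}. f (- j)) = (\<Sum>j\<in>{0..<n}. f j)"
proof -
  \<comment> \<open>Reading the period backwards, \<open>j\<close> to \<open>n - 1 - j\<close>,
    turns the reflection into a shift by \<open>1 - n\<close>.\<close>
  have "(\<Sum>j\<in>{0..<n}. f (- j)) = (\<Sum>j\<in>{0..<n}. f (j + (1 - n)))"
    by (rule sum.reindex_bij_witness[where i = "\<lambda>j. n - 1 - j" and j = "\<lambda>j. n - 1 - j"]) auto
  also have "\<dots> = (\<Sum>j\<in>{0..<n}. f j)"
    by (rule sum_periodic_shift) fact+
  finally show ?thesis .
qed

lemma sum_residue_classes:
  fixes f :: "int \<Rightarrow> 'a::comm_monoid_add"
  assumes "n > 0" and "k \<ge> 0"
  shows "(\<Sum>j\<in>{0..<n * k}. f j) = (\<Sum>m\<in>{0..<n}. \<Sum>r\<in>{0..<k}. f (m + r * n))"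
proof -
  have "bij_betw (\<lambda>(m, r). m + r * n) ({0..<n} \<times> {0..<k}) {0..<n * k}"
  proof (rule bij_betw_byWitness[where f' = "\<lambda>j. (j mod n, j div n)"])
    show "(\<lambda>(m, r). m + r * n) ` ({0..<n} \<times> {0..<k}) \<subseteq> {0..<n * k}"
    proof clarify
      fix m r assume *: "m \<in> {0..<n}" "r \<in> {0..<k}"
      then have "(r + 1) * n \<le> k * n"
        using assms(1) by (intro mult_right_mono) auto
      then show "m + r * n \<in> {0..<n * k}"
        using * assms by (auto simp: algebra_simps)
    qed
    show "(\<lambda>j. (j mod n, j div n)) ` {0..<n * k} \<subseteq> {0..<n} \<times> {0..<k}"
    proof clarify
      fix j assume j: "j \<in> {0..<n * k}"
      have "j div n * n \<le> j"
        using assms(1) using div_mult_mod_eq[of j n] pos_mod_sign[OF assms(1), of j] by linarith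
      also have "j < k * n"
        using j by (simp add: mult.commute)
      finally have "j div n < k"
        using assms(1) by simp
      then show "j mod n \<in> {0..<n} \<and> j div n \<in> {0..<k}"
        using j assms(1) by (auto simp: pos_imp_zdiv_nonneg_iff)
    qed
  qed (use assms in auto)
  then have "(\<Sum>j\<in>{0..<n * k}. f j) = (\<Sum>(m, r)\<in>{0..<n} \<times> {0..<k}. f (m + r * n))"
    by (subst sum.reindex_bij_betw[symmetric]) (auto simp: case_prod_unfold)
  then show ?thesis
    by (simp add: sum.cartesian_product)
qed

text \<open>Shifting the summation index by one multiplies the sum by \<open>ee (k / n)\<close>;
  when that factor differs from 1, the sum must vanish.\<close>

lemma sum_ee_orthogonal:
  fixes n k :: int
  assumes "n > 0"
  shows "(\<Sum>l\<in>{0..<n}. ee (of_int (k * l) / of_int n)) = (if n dvd k then of_int n else 0)"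
proof (cases "n dvd k")
  case True
  then obtain q where q: "k = n * q" by (elim dvdE)
  have "ee (of_int (k * l) / of_int n) = 1" for l
    using assms ee_of_int[of "q * l"] by (simp add: q)
  then show ?thesis
    using True assms by simp
next
  case False
  define S where "S = (\<Sum>l\<in>{0..<n}. ee (of_int (k * l) / of_int n))"
  have "S = (\<Sum>l\<in>{0..<n}. ee (of_int (k * (l + 1)) / of_int n))"
    unfolding S_def
  proof (rule sum_periodic_shift[symmetric, OF assms])
    fix j
    have "(of_int (k * (j + n)) / of_int n :: real) = of_int (k * j) / of_int n + of_int k"
      using assms by (simp add: field_simps)
    then show "ee (of_int (k * (j + n)) / of_int n) = ee (of_int (k * j) / of_int n)"
      by simp
  qed
  also have "\<dots> = ee (of_int k / of_int n) * S"
    unfolding S_def sum_distrib_left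
    by (intro sum.cong refl) (simp add: ee_add[symmetric] add_divide_distrib algebra_simps)
  finally have "(1 - ee (of_int k / of_int n)) * S = 0"
    by (simp add: algebra_simps)
  moreover have "ee (of_int k / of_int n) \<noteq> 1"
  proof
    assume "ee (of_int k / of_int n) = 1"
    then obtain q :: int where "of_int k / of_int n = (of_int q :: real)"
      by (meson Ints_cases ee_eq_1_imp_Ints)
    then have "(of_int k :: real) = of_int (q * n)"
      using assms by (simp add: field_simps)
    then have "k = q * n"
      by linarith
    with False show False by simp
  qed
  ultimately show ?thesis
    using False by (simp add: S_def)
qed

text \<open>Expanding the square leaves character sums at the frequencies \<open>u - v\<close>. The
  bound \<open>k \<le> n\<close> keeps different frequencies in \<open>{0..<k}\<close> different
  modulo \<open>n\<close>, so only the diagonal survives.\<close>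

lemma parseval_sum:
  fixes a :: "int \<Rightarrow> complex" and n k :: int
  assumes "n > 0" "k \<le> n"
  shows "(\<Sum>l\<in>{0..<n}. (cmod (\<Sum>u\<in>{0..<k}. a u * ee (of_int (u * l) / of_int n)))\<^sup>2)
       = of_int n * (\<Sum>u\<in>{0..<k}. (cmod (a u))\<^sup>2)"
proof -
  let ?e = "\<lambda>u l. ee (of_int (u * l) / of_int n)"
  have e: "?e u l * cnj (?e v l) = ?e (u - v) l" for u v l
    by (simp add: cnj_ee ee_add[symmetric] algebra_simps diff_divide_distrib)
  have "complex_of_real (\<Sum>l\<in>{0..<n}. (cmod (\<Sum>u\<in>{0..<k}. a u * ?e u l))\<^sup>2)
      = (\<Sum>l\<in>{0..<n}. (\<Sum>u\<in>{0..<k}. a u * ?e u l) * cnj (\<Sum>u\<in>{0..<k}. a u * ?e u l))"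
    by (simp add: mult_cnj_eq_norm_sq del: cnj_sum)
  also have "\<dots> = (\<Sum>l\<in>{0..<n}. \<Sum>u\<in>{0..<k}. \<Sum>v\<in>{0..<k}. a u * cnj (a v) * ?e (u - v) l)"
    unfolding cnj_sum sum_product e[symmetric]
    by (intro sum.cong refl) (simp add: mult_ac)
  also have "\<dots> = (\<Sum>u\<in>{0..<k}. \<Sum>l\<in>{0..<n}. \<Sum>v\<in>{0..<k}. a u * cnj (a v) * ?e (u - v) l)"
    by (rule sum.swap)
  also have "\<dots> = (\<Sum>u\<in>{0..<k}. \<Sum>v\<in>{0..<k}. \<Sum>l\<in>{0..<n}. a u * cnj (a v) * ?e (u - v) l)"
    by (rule sum.cong[OF refl]) (rule sum.swap)
  also have "\<dots> = (\<Sum>u\<in>{0..<k}. \<Sum>v\<in>{0..<k}. if v = u then a u * cnj (a v) * of_int n else 0)"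
  proof (intro sum.cong refl)
    fix u v assume uv: "u \<in> {0..<k}" "v \<in> {0..<k}"
    then have "n dvd u - v \<longleftrightarrow> v = u"
      using assms dvd_imp_le_int[of "u - v" n] by (cases "u = v") (auto simp: abs_if split: if_splits)
    then show "(\<Sum>l\<in>{0..<n}. a u * cnj (a v) * ?e (u - v) l)
        = (if v = u then a u * cnj (a v) * of_int n else 0)"
      unfolding sum_distrib_left[symmetric] sum_ee_orthogonal[OF assms(1)] by simp
  qed
  also have "\<dots> = (\<Sum>u\<in>{0..<k}. a u * cnj (a u) * of_int n)"
    by (intro sum.cong refl) (simp add: sum.delta')
  also have "\<dots> = complex_of_real (of_int n * (\<Sum>u\<in>{0..<k}. (cmod (a u))\<^sup>2))"
    by (simp add: mult_cnj_eq_norm_sq sum_distrib_left mult.commute)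
  finally show ?thesis
    unfolding of_real_eq_iff .
qed

section \<open>A smoothing kernel\<close>

lemma sum_squares_lessThan_le:
  fixes k :: int
  assumes "k \<ge> 0"
  shows "(\<Sum>u\<in>{0..<k}. (real_of_int u)\<^sup>2) \<le> (real_of_int k) ^ 3 / 3"
  using assms
proof (induction k rule: int_ge_induct)
  case (step i)
  have "{0..<i + 1} = insert i {0..<i}"
    using step.hyps by auto
  then have "(\<Sum>u\<in>{0..<i + 1}. (real_of_int u)\<^sup>2) \<le> (real_of_int i)\<^sup>2 + (real_of_int i) ^ 3 / 3"
    using step.IH by simp
  also have "\<dots> \<le> (real_of_int (i + 1)) ^ 3 / 3"
    using step.hyps by (simp add: power3_eq_cube power2_eq_square field_simps)
  finally show ?case .
qed simp

lemma Cauchy_Schwarz_sum_le: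
  fixes f g :: "'a \<Rightarrow> real"
  assumes "(\<Sum>i\<in>A. (f i)\<^sup>2) \<le> x" "(\<Sum>i\<in>A. (g i)\<^sup>2) \<le> y" "x * y \<le> z\<^sup>2" "z \<ge> 0"
  shows "(\<Sum>i\<in>A. f i * g i) \<le> z"
proof (rule power2_le_imp_le[OF _ assms(4)])
  have "(\<Sum>i\<in>A. f i * g i)\<^sup>2 \<le> (\<Sum>i\<in>A. (f i)\<^sup>2) * (\<Sum>i\<in>A. (g i)\<^sup>2)"
    by (rule Cauchy_Schwarz_ineq_sum)
  also have "\<dots> \<le> x * y"
    using assms(1,2) order_trans[OF sum_nonneg assms(1)] by (intro mult_mono sum_nonneg) auto
  finally show "(\<Sum>i\<in>A. f i * g i)\<^sup>2 \<le> z\<^sup>2"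
    using assms(3) by linarith
qed

section \<open>Dirichlet kernels and their increments\<close>

definition dirichlet :: "int \<Rightarrow> int \<Rightarrow> int \<Rightarrow> complex" where
  "dirichlet d k l = (\<Sum>u\<in>{0..<k}. ee (of_int (u * l) / of_int d))"

lemma dirichlet_periodic:
  assumes "d > 0"
  shows "dirichlet d k (l + d) = dirichlet d k l"
  unfolding dirichlet_def
proof (intro sum.cong refl)
  fix u
  have "(of_int (u * (l + d)) / of_int d :: real) = of_int (u * l) / of_int d + of_int u"
    using assms by (simp add: field_simps)
  then show "ee (of_int (u * (l + d)) / of_int d) = ee (of_int (u * l) / of_int d)"
    by simp
qed

lemma dirichlet_sum_sq:
  assumes "d > 0" "0 \<le> k" "k \<le> d"
  shows "(\<Sum>l\<in>{0..<d}. (cmod (dirichlet d k l))\<^sup>2) = of_int d * of_int k"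
  using parseval_sum[OF assms(1,3), of "\<lambda>_. 1"] assms(2) by (simp add: dirichlet_def)

text \<open>The increment is again a Fourier sum, with coefficients
  \<open>ee (u * h / d) - 1\<close> of size at most \<open>2 * pi * u * h / d\<close>. Parseval
  reduces the claim to a sum of \<open>u^2\<close>, which is where the cube of \<open>k\<close>
  comes from.\<close>

lemma dirichlet_diff_sum_sq:
  assumes "d > 0" "0 \<le> k" "k \<le> d"
  shows "(\<Sum>l\<in>{0..<d}. (cmod (dirichlet d k (l + h) - dirichlet d k l))\<^sup>2)
     \<le> of_int d * ((2 * pi * of_int h / of_int d)\<^sup>2 * (of_int k ^ 3 / 3))"
proof -
  define a where "a u = ee (of_int (u * h) / of_int d) - 1" for u :: int
  have "dirichlet d k (l + h) - dirichlet d k l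
      = (\<Sum>u\<in>{0..<k}. a u * ee (of_int (u * l) / of_int d))" for l
    unfolding dirichlet_def a_def sum_subtractf[symmetric]
    by (intro sum.cong refl) (simp add: algebra_simps add_divide_distrib ee_add)
  then have "(\<Sum>l\<in>{0..<d}. (cmod (dirichlet d k (l + h) - dirichlet d k l))\<^sup>2)
      = of_int d * (\<Sum>u\<in>{0..<k}. (cmod (a u))\<^sup>2)"
    using parseval_sum[OF assms(1,3), of a] by simp
  also have "\<dots> \<le> of_int d * (\<Sum>u\<in>{0..<k}. (2 * pi * of_int h / of_int d)\<^sup>2 * (of_int u)\<^sup>2)"
  proof (intro mult_left_mono sum_mono)
    fix u :: int
    have "(cmod (a u))\<^sup>2 \<le> (2 * pi * \<bar>of_int (u * h) / of_int d\<bar>)\<^sup>2"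
      unfolding a_def by (intro power_mono norm_ee_diff_1_le) auto
    also have "\<dots> = (2 * pi * of_int h / of_int d)\<^sup>2 * (of_int u)\<^sup>2"
      by (simp add: power_mult_distrib power_divide)
    finally show "(cmod (a u))\<^sup>2 \<le> (2 * pi * of_int h / of_int d)\<^sup>2 * (of_int u)\<^sup>2" .
  qed (use assms in auto)
  also have "\<dots> \<le> of_int d * ((2 * pi * of_int h / of_int d)\<^sup>2 * (of_int k ^ 3 / 3))"
    unfolding sum_distrib_left[symmetric]
    using assms by (intro mult_left_mono sum_squares_lessThan_le) auto
  finally show ?thesis .
qed

text \<open>The kernel is the Fourier transform of the trapezoid obtained by averaging the translates
  by \<open>0, -1, \<dots>, -(m - 1)\<close> of the indicator of \<open>{0..<2m}\<close>.\<close>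

definition smoother :: "int \<Rightarrow> int \<Rightarrow> int \<Rightarrow> complex" where
  "smoother d m l = cnj (dirichlet d (2 * m) l) * dirichlet d m l / of_int (d * m)"

definition trapezoid :: "int \<Rightarrow> int \<Rightarrow> int \<Rightarrow> complex" where
  "trapezoid d m j = (\<Sum>l\<in>{0..<d}. smoother d m l * ee (of_int (j * l) / of_int d))"

lemma smoother_periodic: "d > 0 \<Longrightarrow> smoother d m (l + d) = smoother d m l"
  by (simp add: smoother_def dirichlet_periodic)

text \<open>Multiplying out the two Dirichlet kernels and summing over \<open>l\<close> keeps
  exactly the pairs with \<open>u\<close> congruent to \<open>v + j\<close> modulo \<open>d\<close>.
  So each \<open>v\<close> tests whether \<open>v + j\<close> falls into the window
  \<open>{0..<2 * m}\<close>, and the outcomes are averaged.\<close>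

lemma trapezoid_eq:
  assumes "d > 0" "m > 0"
  shows "trapezoid d m j
      = of_nat (\<Sum>v\<in>{0..<m}. card {u\<in>{0..<2 * m}. d dvd v - u + j}) / of_int m"
proof -
  let ?e = "\<lambda>l. ee (of_int l / of_int d)"
  have "trapezoid d m j
      = (\<Sum>l\<in>{0..<d}. \<Sum>v\<in>{0..<m}. \<Sum>u\<in>{0..<2 * m}. ?e ((v - u + j) * l) / of_int (d * m))"
    unfolding trapezoid_def
  proof (intro sum.cong refl)
    fix l
    have *: "cnj (?e (u * l)) * ?e (v * l) * ?e (j * l) = ?e ((v - u + j) * l)" for u v
      by (simp add: cnj_ee ee_add[symmetric] algebra_simps diff_divide_distrib add_divide_distrib)
    have "smoother d m l * ?e (j * l)
        = dirichlet d m l * cnj (dirichlet d (2 * m) l) * ?e (j * l) / of_int (d * m)"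
      by (simp add: smoother_def)
    also have "\<dots> = (\<Sum>v\<in>{0..<m}. \<Sum>u\<in>{0..<2 * m}.
        (cnj (?e (u * l)) * ?e (v * l) * ?e (j * l)) / of_int (d * m))"
      unfolding dirichlet_def cnj_sum sum_product
      unfolding sum_divide_distrib sum_distrib_right
      by (intro sum.cong refl) (simp add: mult_ac)
    finally show "smoother d m l * ?e (j * l)
        = (\<Sum>v\<in>{0..<m}. \<Sum>u\<in>{0..<2 * m}. ?e ((v - u + j) * l) / of_int (d * m))"
      unfolding * .
  qed
  also have "\<dots> = (\<Sum>v\<in>{0..<m}. \<Sum>l\<in>{0..<d}. \<Sum>u\<in>{0..<2 * m}. ?e ((v - u + j) * l) / of_int (d * m))"
    by (rule sum.swap)
  also have "\<dots> = (\<Sum>v\<in>{0..<m}. \<Sum>u\<in>{0..<2 * m}. \<Sum>l\<in>{0..<d}. ?e ((v - u + j) * l) / of_int (d * m))"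
    by (rule sum.cong[OF refl]) (rule sum.swap)
  also have "\<dots> = (\<Sum>v\<in>{0..<m}. \<Sum>u\<in>{0..<2 * m}. if d dvd v - u + j then 1 / of_int m else 0)"
    unfolding sum_divide_distrib[symmetric] sum_ee_orthogonal[OF assms(1)]
    unfolding sum_divide_distrib using assms by (intro sum.cong refl) simp
  also have "\<dots> = of_nat (\<Sum>v\<in>{0..<m}. card {u\<in>{0..<2 * m}. d dvd v - u + j}) / of_int m"
    unfolding of_nat_sum sum_divide_distrib
    by (intro sum.cong refl) (simp add: sum.If_cases Int_def)
  finally show ?thesis .
qed

text \<open>For \<open>v\<close> and \<open>j\<close> below \<open>m\<close> the sum
  \<open>v + j\<close> stays below \<open>2 * m\<close>, so every test succeeds, with the single
  solution \<open>u = v + j\<close>.\<close>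

lemma trapezoid_eq_1:
  assumes "d > 0" "m > 0" "2 * m \<le> d" "0 \<le> j" "j < m"
  shows "trapezoid d m j = 1"
proof -
  have "card {u\<in>{0..<2 * m}. d dvd v - u + j} = 1" if "v \<in> {0..<m}" for v
  proof -
    have "u = v + j" if "u \<in> {0..<2 * m}" "d dvd v - u + j" for u
      using that \<open>v \<in> {0..<m}\<close> assms dvd_imp_le_int[of "v - u + j" d]
      by (cases "v - u + j = 0") (auto simp: abs_if split: if_splits)
    then have "{u\<in>{0..<2 * m}. d dvd v - u + j} = {v + j}"
      using that assms by auto
    then show ?thesis by simp
  qed
  then show ?thesis
    unfolding trapezoid_eq[OF assms(1,2)] using assms(2) by simp
qed

text \<open>Two solutions \<open>u\<close> for the same \<open>v\<close> differ by a multiple of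
  \<open>d\<close> inside a window of length \<open>2 * m \<le> d\<close>, hence coincide. The
  trapezoid is therefore an average of zeros and ones.\<close>

lemma norm_1_minus_trapezoid_le:
  assumes "d > 0" "m > 0" "2 * m \<le> d"
  shows "cmod (1 - trapezoid d m j) \<le> 1"
proof -
  define s where "s = (\<Sum>v\<in>{0..<m}. card {u\<in>{0..<2 * m}. d dvd v - u + j})"
  have "card {u\<in>{0..<2 * m}. d dvd v - u + j} \<le> Suc 0" for v
  proof -
    have "u = w" if *: "u \<in> {u\<in>{0..<2 * m}. d dvd v - u + j}" "w \<in> {u\<in>{0..<2 * m}. d dvd v - u + j}" for u w
    proof -
      have "d dvd (v - u + j) - (v - w + j)"
        using * by (intro dvd_diff) auto
      then show "u = w"
        using * assms dvd_imp_le_int[of "w - u" d]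
        by (cases "u = w") (auto simp: abs_if split: if_splits)
    qed
    moreover have "finite {u\<in>{0..<2 * m}. d dvd v - u + j}"
      by (rule finite_subset[of _ "{0..<2 * m}"]) auto
    ultimately show ?thesis
      using card_le_Suc0_iff_eq by blast
  qed
  then have "s \<le> (\<Sum>v\<in>{0..<m}. Suc 0)"
    unfolding s_def by (intro sum_mono)
  then have s: "real s \<le> of_int m"
    using assms by simp
  have "1 - trapezoid d m j = of_real (1 - real s / of_int m)"
    unfolding trapezoid_eq[OF assms(1,2)] s_def[symmetric] by simp
  then have "cmod (1 - trapezoid d m j) = \<bar>1 - real s / of_int m\<bar>"
    by (simp only: norm_of_real)
  also have "\<dots> \<le> 1"
    using s assms by (auto simp: abs_le_iff field_simps)
  finally show ?thesis .
qed

text \<open>A product rule for increments followed by Cauchy-Schwarz on each term. This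
  \<open>L^1\<close> bound later controls how fast the Zak transform of a smoothed function varies,
  because it multiplies unimodular values.\<close>

lemma sum_norm_smoother_diff_le:
  assumes "d > 0" "m > 0" "2 * m \<le> d" "0 \<le> h" "16 * h * m \<le> d"
  shows "(\<Sum>l\<in>{0..<d}. cmod (smoother d m (l + h) - smoother d m l)) \<le> 1"
proof -
  let ?D = "dirichlet d (2 * m)" and ?E = "dirichlet d m"
  define a where "a = 2 * pi * of_int h / of_int d"
  define w where "w = (of_int d * of_int m :: real)"
  have w: "w > 0"
    using assms by (simp add: w_def)
  have "0 \<le> a * of_int m"
    using assms by (simp add: a_def)
  moreover have "a * of_int m \<le> 2/5"
  proof -
    \<comment> \<open>\<open>a * m = 2 * pi * h * m / d\<close> is at most \<open>pi / 8\<close>,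
      hence at most \<open>2/5\<close>.\<close>
    have "16 * (of_int h * of_int m :: real) \<le> of_int d"
      using assms(5) by (metis mult.assoc of_int_le_iff of_int_mult of_int_numeral)
    then have "of_int h * of_int m / of_int d \<le> (1/16::real)"
      using assms(1) by (simp add: field_simps)
    moreover have "a * of_int m = 2 * pi * (of_int h * of_int m / of_int d)"
      by (simp add: a_def)
    moreover have "2 * pi * (of_int h * of_int m / of_int d) \<le> 2 * pi * (1/16::real)"
      using calculation by (intro mult_left_mono) auto
    ultimately show ?thesis
      using pi_bounds by linarith
  qed
  ultimately have am: "(a * of_int m)\<^sup>2 \<le> 4/25"
    using power_mono[of "a * of_int m" "2/5" 2] by (simp add: power2_eq_square)
  \<comment> \<open>The constants \<open>66/100\<close> and \<open>33/100\<close> exceed the roots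
    of \<open>8/3 * 4/25\<close> and \<open>2/3 * 4/25\<close>, and together stay below 1.\<close>
  have 1: "(\<Sum>l\<in>{0..<d}. cmod (?D (l + h) - ?D l) * cmod (?E (l + h))) \<le> 66/100 * w"
  proof (rule Cauchy_Schwarz_sum_le)
    show "(\<Sum>l\<in>{0..<d}. (cmod (?D (l + h) - ?D l))\<^sup>2) \<le> of_int d * (a\<^sup>2 * (of_int (2 * m) ^ 3 / 3))"
      unfolding a_def using assms by (intro dirichlet_diff_sum_sq) auto
    have "(\<Sum>l\<in>{0..<d}. (cmod (?E (l + h)))\<^sup>2) = (\<Sum>l\<in>{0..<d}. (cmod (?E l))\<^sup>2)"
      by (rule sum_periodic_shift) (use assms in \<open>simp_all add: dirichlet_periodic\<close>)
    then show "(\<Sum>l\<in>{0..<d}. (cmod (?E (l + h)))\<^sup>2) \<le> of_int d * of_int m"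
      using assms by (simp add: dirichlet_sum_sq)
    have "of_int d * (a\<^sup>2 * (of_int (2 * m) ^ 3 / 3)) * (of_int d * of_int m)
        = 8/3 * (a * of_int m)\<^sup>2 * w\<^sup>2"
      by (simp add: w_def power2_eq_square power3_eq_cube)
    also have "\<dots> \<le> (66/100)\<^sup>2 * w\<^sup>2"
      using am by (intro mult_right_mono) (auto simp: power2_eq_square)
    finally show "of_int d * (a\<^sup>2 * (of_int (2 * m) ^ 3 / 3)) * (of_int d * of_int m) \<le> (66/100 * w)\<^sup>2"
      by (simp only: power_mult_distrib)
  qed (use w in simp)
  have 2: "(\<Sum>l\<in>{0..<d}. cmod (?E (l + h) - ?E l) * cmod (?D l)) \<le> 33/100 * w"
  proof (rule Cauchy_Schwarz_sum_le)
    show "(\<Sum>l\<in>{0..<d}. (cmod (?E (l + h) - ?E l))\<^sup>2) \<le> of_int d * (a\<^sup>2 * (of_int m ^ 3 / 3))"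
      unfolding a_def using assms by (intro dirichlet_diff_sum_sq) auto
    show "(\<Sum>l\<in>{0..<d}. (cmod (?D l))\<^sup>2) \<le> of_int d * of_int (2 * m)"
      using assms by (simp add: dirichlet_sum_sq)
    have "of_int d * (a\<^sup>2 * (of_int m ^ 3 / 3)) * (of_int d * of_int (2 * m))
        = 2/3 * (a * of_int m)\<^sup>2 * w\<^sup>2"
      by (simp add: w_def power2_eq_square power3_eq_cube)
    also have "\<dots> \<le> (33/100)\<^sup>2 * w\<^sup>2"
      using am by (intro mult_right_mono) (auto simp: power2_eq_square)
    finally show "of_int d * (a\<^sup>2 * (of_int m ^ 3 / 3)) * (of_int d * of_int (2 * m)) \<le> (33/100 * w)\<^sup>2"
      by (simp only: power_mult_distrib)
  qed (use w in simp)
  have "cmod (smoother d m (l + h) - smoother d m l)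
      \<le> (cmod (?D (l + h) - ?D l) * cmod (?E (l + h)) + cmod (?E (l + h) - ?E l) * cmod (?D l)) / w" for l
  proof -
    have "smoother d m (l + h) - smoother d m l
        = (cnj (?D (l + h) - ?D l) * ?E (l + h) + (?E (l + h) - ?E l) * cnj (?D l)) / of_real w"
      by (simp add: smoother_def w_def diff_divide_distrib[symmetric] algebra_simps)
    also have "cmod \<dots> \<le> (cmod (cnj (?D (l + h) - ?D l) * ?E (l + h)) + cmod ((?E (l + h) - ?E l) * cnj (?D l))) / w"
      using w unfolding norm_divide by (auto intro!: divide_right_mono norm_triangle_ineq)
    finally show ?thesis
      by (simp only: norm_mult complex_mod_cnj)
  qed
  then have "(\<Sum>l\<in>{0..<d}. cmod (smoother d m (l + h) - smoother d m l))
      \<le> (\<Sum>l\<in>{0..<d}. (cmod (?D (l + h) - ?D l) * cmod (?E (l + h)) + cmod (?E (l + h) - ?E l) * cmod (?D l)) / w)"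
    by (intro sum_mono)
  also have "\<dots> \<le> (66/100 * w + 33/100 * w) / w"
    unfolding sum_divide_distrib[symmetric] sum.distrib
    using 1 2 w by (intro divide_right_mono add_mono) auto
  also have "\<dots> \<le> 1"
    using w by simp
  finally show ?thesis .
qed

section \<open>The topological obstruction\<close>

text \<open>The argument measured in full turns, so it lies between \<open>-1/2\<close> and
  \<open>1/2\<close>.\<close>

definition phase :: "complex \<Rightarrow> real" where
  "phase z = Arg z / (2 * pi)"

lemma ee_phase: "cmod z = 1 \<Longrightarrow> ee (phase z) = z"
  unfolding phase_def ee_def using cis_Arg[of z] by (cases "z = 0") (simp_all add: sgn_eq)

text \<open>The distance bound forces \<open>Re z \<ge> 7/32\<close>, which keeps the argument below
  \<open>3/2\<close>. The resulting \<open>6/25\<close> lies just below a quarter turn, so that four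
  such phases do not make up a full turn.\<close>

lemma abs_phase_le:
  assumes "cmod z = 1" "cmod (z - 1) \<le> 5/4"
  shows "\<bar>phase z\<bar> \<le> 6/25"
proof -
  have "(cmod (z - 1))\<^sup>2 = (cmod z)\<^sup>2 + 1 - 2 * Re z"
    unfolding cmod_power2 by (simp add: power2_eq_square algebra_simps)
  moreover have "(cmod (z - 1))\<^sup>2 \<le> (5/4)\<^sup>2"
    using assms(2) by (intro power_mono) auto
  ultimately have "Re z \<ge> 7/32"
    using assms(1) by (simp add: power2_eq_square)
  then have cos: "cos \<bar>Arg z\<bar> \<ge> 7/32"
    using assms(1) by (subst cos_abs_real, subst cos_Arg) auto
  have "\<bar>Arg z\<bar> \<le> 3/2"
  proof (rule ccontr)
    assume "\<not> \<bar>Arg z\<bar> \<le> 3/2"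
    \<comment> \<open>\<open>cos (3/2)\<close> is at most \<open>pi / 2 - 3/2\<close>, hence at most
      \<open>1/10\<close>, which contradicts the bound \<open>7/32\<close>.\<close>
    then have "cos \<bar>Arg z\<bar> < cos (3/2)"
      using Arg_bounded[of z] by (intro cos_monotone_0_pi) auto
    also have "cos (3/2) = sin (pi / 2 - 3/2)"
      by (simp add: cos_sin_eq)
    also have "\<dots> \<le> pi / 2 - 3/2"
      using pi_bounds by (intro sin_x_le_x) auto
    finally show False
      using cos pi_bounds by linarith
  qed
  moreover have "\<bar>phase z\<bar> = \<bar>Arg z\<bar> / (2 * pi)"
    by (simp add: phase_def)
  moreover have "\<bar>Arg z\<bar> / (2 * pi) \<le> (3/2) / (2 * pi)"
    using calculation(1) by (intro divide_right_mono) auto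
  ultimately have "\<bar>phase z\<bar> \<le> (3/2) / (2 * pi)"
    by linarith
  also have "\<dots> \<le> 6/25"
    using pi_bounds by (simp add: field_simps)
  finally show ?thesis .
qed

text \<open>A unimodular function \<open>Z\<close> with the quasi-periodicity of a Zak transform is a section of a
  line bundle of degree one over a torus. In the gauge used here each vertical edge carries the
  connection \<open>ee (x * (y' - y) / n\<^sup>2)\<close>, whose total curvature is one. If \<open>Z\<close> were almost parallel
  along all edges of a grid, then the remaining phases, which are at most \<open>6/25\<close> of a turn each, would cancel exactly around each cell, because
  \<open>4 * (6/25) + 1/256 < 1\<close>.\<close>

lemma no_almost_parallel_section:
  fixes Z :: "int \<Rightarrow> int \<Rightarrow> complex" and n :: int and x y :: "nat \<Rightarrow> int"
  assumes n: "n > 0" and norm: "\<And>p q. cmod (Z p q) = 1"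
    and quasi: "\<And>p q. Z (p + n) q = ee (of_int q / of_int n) * Z p q"
    and per: "\<And>p q. Z p (q + n) = Z p q"
    and x: "x I = x 0 + n" and y: "y J = y 0 + n"
    and cell: "\<And>i j. i < I \<Longrightarrow> j < J \<Longrightarrow> 0 \<le> (x (Suc i) - x i) * (y (Suc j) - y j) \<and>
        256 * ((x (Suc i) - x i) * (y (Suc j) - y j)) \<le> n\<^sup>2"
    and hor: "\<And>i j. i < I \<Longrightarrow> j < J \<Longrightarrow> cmod (Z (x (Suc i)) (y j) - Z (x i) (y j)) \<le> 5/4"
    and ver: "\<And>i j. i < I \<Longrightarrow> j < J \<Longrightarrow>
        cmod (Z (x i) (y (Suc j))
          - ee (of_int (x i * (y (Suc j) - y j)) / of_int (n\<^sup>2)) * Z (x i) (y j)) \<le> 5/4"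
  shows False
proof -
  \<comment> \<open>\<open>g\<close> is the connection on vertical edges, \<open>A\<close> and
    \<open>B\<close> are the phase defects along horizontal and vertical edges, and \<open>F\<close>
    is the curvature of a cell, all phases being in turns.\<close>
  define g where "g i j = ee (of_int (x i * (y (Suc j) - y j)) / of_int (n\<^sup>2))" for i j
  define A where "A i j = phase (Z (x (Suc i)) (y j) / Z (x i) (y j))" for i j
  define B where "B i j = phase (Z (x i) (y (Suc j)) / (g i j * Z (x i) (y j)))" for i j
  define F where "F i j = (of_int ((x (Suc i) - x i) * (y (Suc j) - y j)) / of_int (n\<^sup>2) :: real)" for i j
  have [simp]: "Z p q \<noteq> 0" for p q
    using norm[of p q] by auto
  have [simp]: "g i j \<noteq> 0" "cmod (g i j) = 1" for i j
    by (simp_all add: g_def)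
  have A: "Z (x (Suc i)) (y j) = ee (A i j) * Z (x i) (y j)" for i j
    unfolding A_def by (subst ee_phase) (simp_all add: norm_divide norm)
  have B: "Z (x i) (y (Suc j)) = ee (B i j) * (g i j * Z (x i) (y j))" for i j
    unfolding B_def by (subst ee_phase) (simp_all add: norm_divide norm_mult norm)
  have "I > 0" "J > 0"
    using n x y by (auto intro: gr0I)
  have close: "cmod (z / w - 1) = cmod (z - w)" if "cmod w = 1" for z w :: complex
  proof -
    have "z / w - 1 = (z - w) / w"
      using that by (auto simp: diff_divide_distrib)
    then show ?thesis
      using that by (simp add: norm_divide)
  qed
  have A_J: "A i J = A i 0" for i
    by (simp add: A_def y per)
  \<comment> \<open>Across one period in \<open>x\<close> the connection gains the factor
    \<open>ee ((y (Suc j) - y j) / n)\<close>. This is exactly the ratio of the quasi-periodicity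
    factors of \<open>Z\<close> at the two ends of the edge, so the defects on the two vertical
    sides agree.\<close>
  have B_I: "B I j = B 0 j" for j
  proof -
    have "of_int ((x 0 + n) * (y (Suc j) - y j)) / of_int (n\<^sup>2)
        = of_int (x 0 * (y (Suc j) - y j)) / of_int (n\<^sup>2) + (of_int (y (Suc j) - y j) / of_int n :: real)"
      using n by (simp add: field_simps power2_eq_square)
    then have "g I j = g 0 j * ee (of_int (y (Suc j) - y j) / of_int n)"
      unfolding g_def x by (simp only: ee_add)
    moreover have "ee (of_int (y (Suc j)) / of_int n)
        = ee (of_int (y (Suc j) - y j) / of_int n) * ee (of_int (y j) / of_int n)"
      by (simp add: ee_add[symmetric] add_divide_distrib[symmetric])
    ultimately show ?thesis
      by (simp add: B_def x quasi)
  qed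
  have A_le': "\<bar>A i j\<bar> \<le> 6/25" if "i < I" "j < J" for i j
    unfolding A_def using hor[OF that] by (intro abs_phase_le) (simp_all add: norm_divide norm close)
  have A_le: "\<bar>A i j\<bar> \<le> 6/25" if "i < I" "j \<le> J" for i j
    using A_le'[OF that(1), of j] A_le'[OF that(1) \<open>J > 0\<close>] A_J[of i] that(2) by (cases "j = J") auto
  have B_le': "\<bar>B i j\<bar> \<le> 6/25" if "i < I" "j < J" for i j
    unfolding B_def using ver[OF that]
    by (intro abs_phase_le) (simp_all add: norm_divide norm_mult norm close g_def)
  have B_le: "\<bar>B i j\<bar> \<le> 6/25" if "i \<le> I" "j < J" for i j
    using B_le'[of i, OF _ that(2)] B_le'[OF \<open>I > 0\<close> that(2)] B_I[of j] that(1) by (cases "i = I") auto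
  have cancel: "(B (Suc i) j - B i j) + (A i j - A i (Suc j)) + F i j = 0" if ij: "i < I" "j < J" for i j
  proof -
    let ?S = "(B (Suc i) j - B i j) + (A i j - A i (Suc j)) + F i j"
    have F: "0 \<le> F i j" "F i j \<le> 1/256"
    proof -
      have "256 * (of_int ((x (Suc i) - x i) * (y (Suc j) - y j)) :: real) \<le> of_int (n\<^sup>2)"
        using cell[OF ij] by (metis of_int_le_iff of_int_mult of_int_numeral)
      then show "F i j \<le> 1/256"
        unfolding F_def using n by (simp add: field_simps)
      show "0 \<le> F i j"
        unfolding F_def using cell[OF ij]
        by (intro divide_nonneg_nonneg) (simp_all only: of_int_0_le_iff zero_le_power2)
    qed
    have g_Suc: "g (Suc i) j = ee (F i j) * g i j"
      unfolding g_def F_def ee_add[symmetric] add_divide_distrib[symmetric] of_int_add[symmetric]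
      by (simp add: algebra_simps)
    \<comment> \<open>Both sides compute \<open>Z\<close> at the upper right corner of the cell from
      its lower left corner, along the two possible paths.\<close>
    have "ee (B (Suc i) j) * (ee (F i j) * g i j * (ee (A i j) * Z (x i) (y j)))
        = ee (A i (Suc j)) * (ee (B i j) * (g i j * Z (x i) (y j)))"
      using A[of i "Suc j"] B[of "Suc i" j] A[of i j] B[of i j] g_Suc by simp
    then have "ee (B (Suc i) j) * ee (F i j) * ee (A i j) = ee (A i (Suc j)) * ee (B i j)"
      by (simp add: mult.assoc)
    then have "ee (B (Suc i) j + F i j + A i j) = ee (A i (Suc j) + B i j)"
      by (simp add: ee_add)
    moreover have "ee ?S * ee (A i (Suc j) + B i j) = ee (B (Suc i) j + F i j + A i j)"
      by (simp add: ee_add[symmetric] add_ac)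
    ultimately have "ee ?S = 1"
      by simp
    then obtain k :: int where k: "?S = of_int k"
      by (meson Ints_cases ee_eq_1_imp_Ints)
    have "\<bar>?S\<bar> < 1"
      using A_le[OF ij(1), of j] A_le[OF ij(1), of "Suc j"] B_le[OF _ ij(2), of i] B_le[OF _ ij(2), of "Suc i"]
        ij F by (auto simp: abs_le_iff abs_less_iff)
    then show ?thesis
      using k by simp
  qed
  have tele: "(\<Sum>i<k. f (Suc i) - f i) = f k - f 0" for f :: "nat \<Rightarrow> real" and k
    by (simp add: sum_lessThan_telescope)
  have tele_int: "(\<Sum>i<k. f (Suc i) - f i) = f k - f 0" for f :: "nat \<Rightarrow> int" and k
    by (simp add: sum_lessThan_telescope)
  \<comment> \<open>Summed over all cells, the differences of \<open>A\<close> and \<open>B\<close>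
    telescope to zero by the boundary identifications, while the curvatures add up to
    \<open>n * n / n^2 = 1\<close>. This yields \<open>0 = 1\<close>.\<close>
  have "0 = (\<Sum>j<J. \<Sum>i<I. (B (Suc i) j - B i j) + (A i j - A i (Suc j)) + F i j)"
    using cancel by simp
  also have "\<dots> = (\<Sum>j<J. \<Sum>i<I. B (Suc i) j - B i j) + (\<Sum>j<J. \<Sum>i<I. A i j - A i (Suc j))
      + (\<Sum>j<J. \<Sum>i<I. F i j)"
    by (simp only: sum.distrib)
  also have "(\<Sum>j<J. \<Sum>i<I. B (Suc i) j - B i j) = 0"
    using tele[of "\<lambda>i. B i j" I for j] by (simp add: B_I)
  also have "(\<Sum>j<J. \<Sum>i<I. A i j - A i (Suc j)) = 0"
    using sum_lessThan_telescope'[of "A i" J for i] by (subst sum.swap) (simp add: A_J)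
  also have "(\<Sum>j<J. \<Sum>i<I. F i j) = 1"
  proof -
    have "(\<Sum>j<J. \<Sum>i<I. F i j)
        = of_int ((\<Sum>i<I. x (Suc i) - x i) * (\<Sum>j<J. y (Suc j) - y j)) / of_int (n\<^sup>2)"
      unfolding sum_product of_int_sum sum_divide_distrib F_def by (rule sum.swap)
    also have "\<dots> = 1"
      unfolding tele_int x y using n by (simp add: power2_eq_square)
    finally show ?thesis .
  qed
  finally show False
    by simp
qed


text \<open>If the errors at the points of one translated grid summed to less than
  \<open>1/64\<close>, then \<open>Z\<close> would lie within \<open>1/8\<close> of both smoothings
  at every grid point and change by at most \<open>5/4\<close> along each edge, against
  \<open>no_almost_parallel_section\<close>. Averaging over all translates turns this pointwise
  obstruction into an \<open>L^2\<close> bound.\<close>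

lemma sum_smoothing_error_ge:
  fixes Z Z1 Z2 :: "int \<Rightarrow> int \<Rightarrow> complex" and n k l :: int
  defines "E \<equiv> \<lambda>p q. (cmod (Z p q - Z1 p q))\<^sup>2 + (cmod (Z p q - Z2 p q))\<^sup>2"
  assumes n: "n > 0" and norm: "\<And>p q. cmod (Z p q) = 1"
    and quasi: "\<And>p q. Z (p + n) q = ee (of_int q / of_int n) * Z p q"
    and per: "\<And>p q. Z p (q + n) = Z p q"
    and E1: "\<And>p q. E (p + n) q = E p q" and E2: "\<And>p q. E p (q + n) = E p q"
    and kl: "k > 0" "l > 0" "256 * (k * l) \<le> n\<^sup>2"
    and hor: "\<And>p q h. 0 \<le> h \<Longrightarrow> h \<le> k \<Longrightarrow> cmod (Z1 (p + h) q - Z1 p q) \<le> 1"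
    and ver: "\<And>p q h. 0 \<le> h \<Longrightarrow> h \<le> l \<Longrightarrow>
        cmod (Z2 p (q + h) - ee (of_int (p * h) / of_int (n\<^sup>2)) * Z2 p q) \<le> 1"
  shows "(of_int n)\<^sup>2 \<le> 64 * of_int (n div k + 1) * of_int (n div l + 1) *
    (\<Sum>p\<in>{0..<n}. \<Sum>q\<in>{0..<n}. E p q)"
proof -
  define I where "I = nat (n div k + 1)"
  define J where "J = nat (n div l + 1)"
  \<comment> \<open>Truncating at \<open>n\<close> makes the grid close up after exactly one period.
    The last step may have length zero, which the cell condition permits.\<close>
  define a where "a i = min (int i * k) n" for i
  define c where "c j = min (int j * l) n" for j
  have "n div k \<ge> 0" "n div l \<ge> 0"
    using n kl by (simp_all add: pos_imp_zdiv_nonneg_iff)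
  then have I: "int I = n div k + 1" and J: "int J = n div l + 1"
    by (simp_all add: I_def J_def)
  have large: "(n div t + 1) * t \<ge> n" if "t > 0" for t
  proof -
    have "(n div t + 1) * t = n div t * t + t"
      by (simp add: distrib_right)
    then show ?thesis
      using div_mult_mod_eq[of n t] pos_mod_bound[OF that, of n] by linarith
  qed
  have a: "a 0 = 0" "a I = n" and c: "c 0 = 0" "c J = n"
    using n kl large by (simp_all add: a_def c_def I J)
  have a_Suc: "0 \<le> a (Suc i) - a i" "a (Suc i) - a i \<le> k"
    and c_Suc: "0 \<le> c (Suc i) - c i" "c (Suc i) - c i \<le> l" for i
    using kl by (auto simp: a_def c_def algebra_simps min_def)
  have one: "1/64 \<le> (\<Sum>i<I. \<Sum>j<J. E (s + a i) (t + c j))" for s t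
  proof (rule ccontr)
    assume "\<not> 1/64 \<le> (\<Sum>i<I. \<Sum>j<J. E (s + a i) (t + c j))"
    then have small: "(\<Sum>i<I. \<Sum>j<J. E (s + a i) (t + c j)) < 1/64"
      by simp
    have E_nonneg: "E p q \<ge> 0" for p q
      by (simp add: E_def)
    have E_lt: "E (s + a i) (t + c j) < 1/64" if "i < I" "j < J" for i j
    proof -
      have "E (s + a i) (t + c j) \<le> (\<Sum>j<J. E (s + a i) (t + c j))"
        using that E_nonneg by (intro member_le_sum) auto
      also have "\<dots> \<le> (\<Sum>i<I. \<Sum>j<J. E (s + a i) (t + c j))"
        using that E_nonneg
        by (intro member_le_sum[of i "{..<I}" "\<lambda>i. \<Sum>j<J. E (s + a i) (t + c j)"] sum_nonneg) auto
      finally show ?thesis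
        using small by simp
    qed
    have "I > 0" "J > 0"
      using I J \<open>n div k \<ge> 0\<close> \<open>n div l \<ge> 0\<close> by linarith+
    \<comment> \<open>Points with index \<open>I\<close> or \<open>J\<close> are identified with
      those of index 0 by the periodicity of \<open>E\<close>.\<close>
    then have E_lt': "E (s + a i) (t + c j) < 1/64" if "i \<le> I" "j \<le> J" for i j
      using that E_lt[of i j] E_lt[of 0 j] E_lt[of i 0] E_lt[of 0 0] E1[of s] E2[of _ t]
      by (cases "i = I"; cases "j = J") (simp_all add: a c)
    have lt: "cmod (Z (s + a i) (t + c j) - Z1 (s + a i) (t + c j)) < 1/8"
      "cmod (Z (s + a i) (t + c j) - Z2 (s + a i) (t + c j)) < 1/8" if "i \<le> I" "j \<le> J" for i j
    proof -
      have sq: "u < 1/8" if "u\<^sup>2 + v < 1/64" "v \<ge> 0" for u v :: real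
        using that by (intro power_less_imp_less_base[of u 2 "1/8"]) (auto simp: power2_eq_square)
      have e: "(cmod (Z (s + a i) (t + c j) - Z1 (s + a i) (t + c j)))\<^sup>2
          + (cmod (Z (s + a i) (t + c j) - Z2 (s + a i) (t + c j)))\<^sup>2 < 1/64"
        using E_lt'[OF that] by (simp add: E_def)
      show "cmod (Z (s + a i) (t + c j) - Z1 (s + a i) (t + c j)) < 1/8"
        by (rule sq[OF e]) simp
      show "cmod (Z (s + a i) (t + c j) - Z2 (s + a i) (t + c j)) < 1/8"
        by (rule sq[OF e[unfolded add.commute[of "(cmod (Z (s + a i) (t + c j) - Z1 (s + a i) (t + c j)))\<^sup>2"]]]) simp
    qed
    \<comment> \<open>\<open>5/4 = 1/8 + 1 + 1/8\<close>. The factor \<open>g\<close> is 1 on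
      horizontal edges and the connection on vertical ones.\<close>
    have tri: "cmod (z' - g * z) \<le> 5/4"
      if "cmod (z' - w') < 1/8" "cmod (z - w) < 1/8" "cmod (w' - g * w) \<le> 1" "cmod g = 1"
      for z z' w w' g :: complex
    proof -
      have "z' - g * z = (z' - w') + (w' - g * w) - g * (z - w)"
        by (simp add: algebra_simps)
      also have "cmod \<dots> \<le> cmod (z' - w') + cmod (w' - g * w) + cmod (g * (z - w))"
        by (meson add_mono norm_triangle_ineq norm_triangle_ineq4 order_refl order_trans)
      finally show ?thesis
        using that by (simp add: norm_mult)
    qed
    show False
    proof (rule no_almost_parallel_section[where Z = Z and x = "\<lambda>i. s + a i" and y = "\<lambda>j. t + c j"
          and I = I and J = J, OF n norm quasi per])
      fix i j assume ij: "i < I" "j < J"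
      have "(a (Suc i) - a i) * (c (Suc j) - c j) \<le> k * l"
        using a_Suc[of i] c_Suc[of j] kl by (intro mult_mono) auto
      then show "0 \<le> (s + a (Suc i) - (s + a i)) * (t + c (Suc j) - (t + c j)) \<and>
          256 * ((s + a (Suc i) - (s + a i)) * (t + c (Suc j) - (t + c j))) \<le> n\<^sup>2"
        using a_Suc[of i] c_Suc[of j] kl by auto
      show "cmod (Z (s + a (Suc i)) (t + c j) - Z (s + a i) (t + c j)) \<le> 5/4"
        using tri[OF lt(1)[of "Suc i" j] lt(1)[of i j], of 1] ij
          hor[OF a_Suc(1)[of i] a_Suc(2)[of i], of "s + a i" "t + c j"] by simp
      show "cmod (Z (s + a i) (t + c (Suc j)) - ee (of_int ((s + a i) * (t + c (Suc j) - (t + c j)))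
          / of_int (n\<^sup>2)) * Z (s + a i) (t + c j)) \<le> 5/4"
        using tri[OF lt(2)[of i "Suc j"] lt(2)[of i j]] ij
          ver[OF c_Suc(1)[of j] c_Suc(2)[of j], of "s + a i" "t + c j"] by simp
    qed (simp_all add: a c)
  qed
  have "(of_int n)\<^sup>2 / 64 = (\<Sum>s\<in>{0..<n}. \<Sum>t\<in>{0..<n}. 1/64 :: real)"
    using n by (simp add: power2_eq_square)
  \<comment> \<open>For fixed \<open>i\<close> and \<open>j\<close> the translated point runs once
    through the whole torus, so each of the \<open>I * J\<close> grid positions contributes the full
    sum of \<open>E\<close>.\<close>
  also have "\<dots> \<le> (\<Sum>s\<in>{0..<n}. \<Sum>t\<in>{0..<n}. \<Sum>i<I. \<Sum>j<J. E (s + a i) (t + c j))"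
    by (intro sum_mono one)
  also have "\<dots> = (\<Sum>s\<in>{0..<n}. \<Sum>i<I. \<Sum>t\<in>{0..<n}. \<Sum>j<J. E (s + a i) (t + c j))"
    by (rule sum.cong[OF refl]) (rule sum.swap)
  also have "\<dots> = (\<Sum>s\<in>{0..<n}. \<Sum>i<I. \<Sum>j<J. \<Sum>t\<in>{0..<n}. E (s + a i) (t + c j))"
    by (rule sum.cong[OF refl], rule sum.cong[OF refl]) (rule sum.swap)
  also have "\<dots> = (\<Sum>s\<in>{0..<n}. \<Sum>i<I. \<Sum>j<J. \<Sum>t\<in>{0..<n}. E (s + a i) t)"
    by (intro sum.cong refl sum_periodic_shift n E2)
  also have "\<dots> = (\<Sum>i<I. \<Sum>s\<in>{0..<n}. of_nat J * (\<Sum>t\<in>{0..<n}. E (s + a i) t))"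
    by (subst sum.swap) simp
  also have "\<dots> = (\<Sum>i<I. \<Sum>s\<in>{0..<n}. of_nat J * (\<Sum>t\<in>{0..<n}. E s t))"
    by (intro sum.cong refl sum_periodic_shift[where f = "\<lambda>s. of_nat J * (\<Sum>t\<in>{0..<n}. E s t)"] n)
      (simp add: E1)
  also have "\<dots> = of_nat I * of_nat J * (\<Sum>p\<in>{0..<n}. \<Sum>q\<in>{0..<n}. E p q)"
    by (simp add: sum_distrib_left mult.assoc)
  also have "real I = of_int (n div k + 1)"
    by (metis I of_int_of_nat_eq)
  also have "real J = of_int (n div l + 1)"
    by (metis J of_int_of_nat_eq)
  finally show ?thesis
    by (simp add: algebra_simps)
qed

section \<open>The finite Zak transform\<close>

text \<open>An unnormalised Fourier sum along the coset of \<open>p\<close> modulo \<open>n\<close>;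
  with this scaling an orthonormal Gabor system gives values of modulus 1.\<close>

definition zak :: "int \<Rightarrow> (int \<Rightarrow> complex) \<Rightarrow> int \<Rightarrow> int \<Rightarrow> complex" where
  "zak n f p q = (\<Sum>j\<in>{0..<n}. f (p - j * n) * ee (of_int (j * q) / of_int n))"

lemma zak_diff: "zak n (\<lambda>j. f j - g j) p q = zak n f p q - zak n g p q"
  by (simp add: zak_def sum_subtractf left_diff_distrib)

lemma ee_shift_period:
  assumes "n > 0"
  shows "ee (of_int (j * (q + k * n)) / of_int n) = ee (of_int (j * q) / of_int n)"
proof -
  have "(of_int (j * (q + k * n)) / of_int n :: real) = of_int (j * q) / of_int n + of_int (j * k)"
    using assms by (simp add: field_simps)
  then show ?thesis
    by (simp only: ee_add_int)
qed

lemma zak_periodic_snd: "n > 0 \<Longrightarrow> zak n f p (q + k * n) = zak n f p q"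
  unfolding zak_def by (simp only: ee_shift_period)

lemma zak_periodic_fst:
  assumes "\<And>j. f (j + n\<^sup>2) = f j"
  shows "zak n f (p + n\<^sup>2) q = zak n f p q"
  unfolding zak_def
proof (intro sum.cong refl)
  fix j
  show "f (p + n\<^sup>2 - j * n) * ee (of_int (j * q) / of_int n) = f (p - j * n) * ee (of_int (j * q) / of_int n)"
    using assms[of "p - j * n"] by (simp add: algebra_simps)
qed

text \<open>Moving \<open>p\<close> by \<open>n\<close> shifts the index \<open>j\<close> by one,
  which pulls one character out of a sum over a full period.\<close>

lemma zak_quasiperiodic:
  assumes "n > 0" and per: "\<And>j. f (j + n\<^sup>2) = f j"
  shows "zak n f (p + n) q = ee (of_int q / of_int n) * zak n f p q"
proof -
  define g where "g j = f (p - j * n) * ee (of_int (j * q) / of_int n)" for j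
  have g_per: "g (j + n) = g j" for j
    using per[of "p - (j + n) * n"] ee_shift_period[OF assms(1), of q j 1]
    by (simp add: g_def power2_eq_square algebra_simps)
  have e: "ee (of_int (j * q) / of_int n) = ee (of_int q / of_int n) * ee (of_int ((j + - 1) * q) / of_int n)" for j
  proof -
    have "of_int (j * q) / of_int n = of_int q / of_int n + (of_int ((j + - 1) * q) / of_int n :: real)"
      using assms(1) by (simp add: field_simps)
    then show ?thesis
      by (simp only: ee_add)
  qed
  have "zak n f (p + n) q = (\<Sum>j\<in>{0..<n}. ee (of_int q / of_int n) * g (j + - 1))"
    unfolding zak_def g_def
  proof (rule sum.cong[OF refl])
    fix j
    have "p - (j + - 1) * n = p + n - j * n"
      by (simp add: algebra_simps)
    then show "f (p + n - j * n) * ee (of_int (j * q) / of_int n) = ee (of_int q / of_int n) *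
        (f (p - (j + - 1) * n) * ee (of_int ((j + - 1) * q) / of_int n))"
      unfolding e[of j] by (simp only: mult_ac)
  qed
  also have "\<dots> = ee (of_int q / of_int n) * (\<Sum>j\<in>{0..<n}. g j)"
    unfolding sum_distrib_left[symmetric] sum_periodic_shift[where f = g, OF assms(1) g_per] ..
  finally show ?thesis
    by (simp add: zak_def g_def)
qed

text \<open>Parseval on each coset of multiples of \<open>n\<close>, after which the cosets
  reassemble into \<open>{0..<n^2}\<close>. The reflection accounts for the sign in
  \<open>p - j * n\<close>.\<close>

lemma zak_sum_sq:
  assumes "n > 0" and per: "\<And>j. f (j + n\<^sup>2) = f j"
  shows "(\<Sum>p\<in>{0..<n}. \<Sum>q\<in>{0..<n}. (cmod (zak n f p q))\<^sup>2)
    = of_int n * (\<Sum>j\<in>{0..<n\<^sup>2}. (cmod (f j))\<^sup>2)"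
proof -
  have "(\<Sum>p\<in>{0..<n}. \<Sum>q\<in>{0..<n}. (cmod (zak n f p q))\<^sup>2)
      = (\<Sum>p\<in>{0..<n}. of_int n * (\<Sum>j\<in>{0..<n}. (cmod (f (p + (- j) * n)))\<^sup>2))"
  proof (rule sum.cong[OF refl])
    fix p
    show "(\<Sum>q\<in>{0..<n}. (cmod (zak n f p q))\<^sup>2) = of_int n * (\<Sum>j\<in>{0..<n}. (cmod (f (p + (- j) * n)))\<^sup>2)"
      using parseval_sum[OF assms(1) order_refl, of "\<lambda>j. f (p - j * n)"] by (simp add: zak_def)
  qed
  also have "\<dots> = (\<Sum>p\<in>{0..<n}. of_int n * (\<Sum>j\<in>{0..<n}. (cmod (f (p + j * n)))\<^sup>2))"
  proof (rule sum.cong[OF refl])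
    fix p
    have "(cmod (f (p + (j + n) * n)))\<^sup>2 = (cmod (f (p + j * n)))\<^sup>2" for j
      using per[of "p + j * n"] by (simp add: power2_eq_square algebra_simps)
    then show "of_int n * (\<Sum>j\<in>{0..<n}. (cmod (f (p + (- j) * n)))\<^sup>2)
        = of_int n * (\<Sum>j\<in>{0..<n}. (cmod (f (p + j * n)))\<^sup>2)"
      using sum_periodic_reflect[where f = "\<lambda>j. (cmod (f (p + j * n)))\<^sup>2", OF assms(1)] by simp
  qed
  also have "\<dots> = of_int n * (\<Sum>j\<in>{0..<n\<^sup>2}. (cmod (f j))\<^sup>2)"
    unfolding sum_distrib_left[symmetric] power2_eq_square[of n]
    using assms(1) by (subst sum_residue_classes) auto
  finally show ?thesis .
qed

text \<open>As a function of \<open>q\<close>, \<open>|Z|^2\<close> has the autocorrelations of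
  \<open>f\<close> along one coset as Fourier coefficients. Orthogonality to all translates and
  modulations forces these to be 1 at lag zero and 0 at the other lags.\<close>

lemma norm_zak_eq_1:
  assumes n: "n > 0" and per: "\<And>j. f (j + n\<^sup>2) = f j"
    and orth: "\<And>s t. s \<in> {0..<n} \<Longrightarrow> t \<in> {0..<n} \<Longrightarrow>
      (\<Sum>j\<in>{0..<n\<^sup>2}. ee (of_int (t * j) / of_int n) * f (j - s * n) * cnj (f j))
        = (if s = 0 \<and> t = 0 then of_int n else 0)"
  shows "cmod (zak n f p q) = 1"
proof -
  let ?e = "\<lambda>k. ee (of_int k / of_int n)"
  have e_period: "?e (t * (m + r * n)) = ?e (t * m)" for t m r
    by (rule ee_shift_period[OF n])
  have f_period: "f (j - n\<^sup>2) = f j" for j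
    using per[of "j - n\<^sup>2"] by simp
  define r where "r s m = (\<Sum>i\<in>{0..<n}. f (m + i * n - s * n) * cnj (f (m + i * n)))" for s m
  have r: "r s m = (if s = 0 then 1 else 0)" if s: "s \<in> {0..<n}" and m: "m \<in> {0..<n}" for s m
  proof -
    have coeff: "(\<Sum>m'\<in>{0..<n}. ?e (t * m') * r s m') = (if s = 0 \<and> t = 0 then of_int n else 0)"
      if "t \<in> {0..<n}" for t
    proof -
      have "(\<Sum>j\<in>{0..<n\<^sup>2}. ?e (t * j) * f (j - s * n) * cnj (f j))
          = (\<Sum>m'\<in>{0..<n}. \<Sum>i\<in>{0..<n}. ?e (t * (m' + i * n)) * f (m' + i * n - s * n) * cnj (f (m' + i * n)))"
        unfolding power2_eq_square using n by (subst sum_residue_classes) auto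
      also have "\<dots> = (\<Sum>m'\<in>{0..<n}. ?e (t * m') * r s m')"
        unfolding e_period r_def sum_distrib_left by (simp only: mult.assoc)
      finally show ?thesis
        using orth[OF s that] by simp
    qed
    \<comment> \<open>Fourier inversion in the modulation parameter \<open>t\<close> isolates the
      autocorrelation on the single coset of \<open>m\<close>.\<close>
    have "(\<Sum>t\<in>{0..<n}. ?e (- (t * m)) * (\<Sum>m'\<in>{0..<n}. ?e (t * m') * r s m'))
        = (\<Sum>t\<in>{0..<n}. if t = 0 then (if s = 0 then of_int n else 0) else 0)"
    proof (rule sum.cong[OF refl])
      fix t assume t: "t \<in> {0..<n}"
      show "?e (- (t * m)) * (\<Sum>m'\<in>{0..<n}. ?e (t * m') * r s m')
          = (if t = 0 then (if s = 0 then of_int n else 0) else 0)"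
        unfolding coeff[OF t] by simp
    qed
    also have "\<dots> = (if s = 0 then of_int n else 0)"
      using n by simp
    finally have 1: "(\<Sum>t\<in>{0..<n}. ?e (- (t * m)) * (\<Sum>m'\<in>{0..<n}. ?e (t * m') * r s m'))
        = (if s = 0 then of_int n else 0)" .
    have e_mult: "?e (- (t * m)) * ?e (t * m') = ?e ((m' - m) * t)" for t m'
    proof -
      have "- (t * m) + t * m' = (m' - m) * t"
        by (simp add: algebra_simps)
      then show ?thesis
        by (simp only: ee_mult_int)
    qed
    have "(\<Sum>t\<in>{0..<n}. ?e (- (t * m)) * (\<Sum>m'\<in>{0..<n}. ?e (t * m') * r s m'))
        = (\<Sum>t\<in>{0..<n}. \<Sum>m'\<in>{0..<n}. ?e ((m' - m) * t) * r s m')"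
      unfolding sum_distrib_left mult.assoc[symmetric] e_mult ..
    also have "\<dots> = (\<Sum>m'\<in>{0..<n}. (\<Sum>t\<in>{0..<n}. ?e ((m' - m) * t)) * r s m')"
      unfolding sum_distrib_right by (rule sum.swap)
    also have "\<dots> = (\<Sum>m'\<in>{0..<n}. if m' = m then of_int n * r s m else 0)"
    proof (rule sum.cong[OF refl])
      fix m' assume "m' \<in> {0..<n}"
      then have "n dvd m' - m \<longleftrightarrow> m' = m"
        using m dvd_imp_le_int[of "m' - m" n] by (cases "m' = m") (auto simp: abs_if split: if_splits)
      then show "(\<Sum>t\<in>{0..<n}. ?e ((m' - m) * t)) * r s m' = (if m' = m then of_int n * r s m else 0)"
        unfolding sum_ee_orthogonal[OF n] by simp
    qed
    also have "\<dots> = of_int n * r s m"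
      using m by simp
    finally show ?thesis
      using 1 n by (auto split: if_splits)
  qed
  have main: "cmod (zak n f p q) = 1" if p: "p \<in> {0..<n}" for p
  proof -
    have "zak n f p q * cnj (zak n f p q) = (\<Sum>i\<in>{0..<n}. \<Sum>j\<in>{0..<n}.
        f (p - i * n) * (?e (i * q) * cnj (?e (j * q))) * cnj (f (p - j * n)))"
      unfolding zak_def cnj_sum sum_product complex_cnj_mult by (simp only: mult_ac)
    also have "\<dots> = (\<Sum>i\<in>{0..<n}. \<Sum>j\<in>{0..<n}. f (p - i * n) * ?e ((i - j) * q) * cnj (f (p - j * n)))"
      unfolding ee_mult_cnj_int left_diff_distrib ..
    also have "\<dots> = (\<Sum>j\<in>{0..<n}. (\<Sum>i\<in>{0..<n}. f (p - i * n) * ?e ((i - j) * q)) * cnj (f (p - j * n)))"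
      unfolding sum_distrib_right by (rule sum.swap)
    also have "\<dots> = (\<Sum>j\<in>{0..<n}. (\<Sum>s\<in>{0..<n}. f (p - (s + j) * n) * ?e (s * q)) * cnj (f (p - j * n)))"
    proof (rule sum.cong[OF refl], rule arg_cong2[where f = "(*)", OF _ refl])
      fix j
      have "f (p - (i + n) * n) * ?e ((i + n - j) * q) = f (p - i * n) * ?e ((i - j) * q)" for i
        using f_period[of "p - i * n"] e_period[of q "i - j" 1]
        by (simp add: power2_eq_square algebra_simps)
      then have "(\<Sum>i\<in>{0..<n}. f (p - (i + j) * n) * ?e ((i + j - j) * q))
          = (\<Sum>i\<in>{0..<n}. f (p - i * n) * ?e ((i - j) * q))"
        by (intro sum_periodic_shift[where f = "\<lambda>i. f (p - i * n) * ?e ((i - j) * q)"] n)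
      then show "(\<Sum>i\<in>{0..<n}. f (p - i * n) * ?e ((i - j) * q))
          = (\<Sum>s\<in>{0..<n}. f (p - (s + j) * n) * ?e (s * q))"
        by simp
    qed
    also have "\<dots> = (\<Sum>j\<in>{0..<n}. \<Sum>s\<in>{0..<n}. ?e (s * q) * (f (p - (s + j) * n) * cnj (f (p - j * n))))"
      unfolding sum_distrib_right by (simp only: mult_ac)
    also have "\<dots> = (\<Sum>s\<in>{0..<n}. \<Sum>j\<in>{0..<n}. ?e (s * q) * (f (p - (s + j) * n) * cnj (f (p - j * n))))"
      by (rule sum.swap)
    also have "\<dots> = (\<Sum>s\<in>{0..<n}. ?e (s * q) * (\<Sum>j\<in>{0..<n}. f (p + (- j) * n - s * n) * cnj (f (p + (- j) * n))))"
      unfolding sum_distrib_left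
    proof (rule sum.cong[OF refl], rule sum.cong[OF refl])
      fix s j
      have "p - (s + j) * n = p + (- j) * n - s * n" "p - j * n = p + (- j) * n"
        by (simp_all add: algebra_simps)
      then show "?e (s * q) * (f (p - (s + j) * n) * cnj (f (p - j * n)))
          = ?e (s * q) * (f (p + (- j) * n - s * n) * cnj (f (p + (- j) * n)))"
        by (simp only:)
    qed
    also have "\<dots> = (\<Sum>s\<in>{0..<n}. ?e (s * q) * r s p)"
    proof (rule sum.cong[OF refl], rule arg_cong2[where f = "(*)", OF refl])
      fix s
      have "f (p + (j + n) * n - s * n) * cnj (f (p + (j + n) * n))
          = f (p + j * n - s * n) * cnj (f (p + j * n))" for j
        using per[of "p + j * n - s * n"] per[of "p + j * n"] by (simp add: power2_eq_square algebra_simps)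
      then show "(\<Sum>j\<in>{0..<n}. f (p + (- j) * n - s * n) * cnj (f (p + (- j) * n))) = r s p"
        unfolding r_def
        by (intro sum_periodic_reflect[where f = "\<lambda>j. f (p + j * n - s * n) * cnj (f (p + j * n))"] n)
    qed
    also have "\<dots> = (\<Sum>s\<in>{0..<n}. if s = 0 then 1 else 0)"
      using p by (intro sum.cong refl) (simp add: r)
    also have "\<dots> = 1"
      using n by simp
    finally have "(complex_of_real (cmod (zak n f p q)))\<^sup>2 = 1"
      by (simp only: mult_cnj_eq_norm_sq)
    then have "(cmod (zak n f p q))\<^sup>2 = 1"
      by (metis of_real_eq_1_iff of_real_power)
    then show ?thesis
      by (simp add: power2_eq_1_iff) (smt (verit) norm_ge_zero)
  qed
  \<comment> \<open>The quasi-periodicity factor has modulus 1, so the claim for \<open>p\<close> in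
    \<open>{0..<n}\<close> extends to all \<open>p\<close>.\<close>
  have "cmod (zak n f (p + n) q) = cmod (zak n f p q)" for p
    by (simp add: zak_quasiperiodic[where f = f, OF n per] norm_mult)
  then have "cmod (zak n f (p mod n) q) = cmod (zak n f p q)"
    by (rule periodic_mod[where f = "\<lambda>p. cmod (zak n f p q)"])
  then show ?thesis
    using main[of "p mod n"] n by simp
qed

section \<open>Low-pass filter and cutoff on the Zak side\<close>

definition lowpass :: "int \<Rightarrow> int \<Rightarrow> (int \<Rightarrow> complex) \<Rightarrow> int \<Rightarrow> complex" where
  "lowpass d m f j = (\<Sum>l\<in>{0..<d}. smoother d m l * f (j + l))"

definition cutoff :: "int \<Rightarrow> int \<Rightarrow> (int \<Rightarrow> complex) \<Rightarrow> int \<Rightarrow> complex" where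
  "cutoff d m f j = trapezoid d m j * f j"

lemma zak_lowpass: "zak n (lowpass d m f) p q = (\<Sum>l\<in>{0..<d}. smoother d m l * zak n f (p + l) q)"
proof -
  have "zak n (lowpass d m f) p q
      = (\<Sum>j\<in>{0..<n}. \<Sum>l\<in>{0..<d}. smoother d m l * f (p - j * n + l) * ee (of_int (j * q) / of_int n))"
    by (simp add: zak_def lowpass_def sum_distrib_right)
  also have "\<dots> = (\<Sum>l\<in>{0..<d}. \<Sum>j\<in>{0..<n}. smoother d m l * f (p - j * n + l) * ee (of_int (j * q) / of_int n))"
    by (rule sum.swap)
  also have "\<dots> = (\<Sum>l\<in>{0..<d}. smoother d m l * zak n f (p + l) q)"
    unfolding zak_def sum_distrib_left by (intro sum.cong refl) (simp add: algebra_simps)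
  finally show ?thesis .
qed

text \<open>At the point \<open>p - j * n\<close> the character of frequency \<open>l\<close> splits
  into a phase depending on \<open>p\<close> and a factor that moves \<open>q\<close> to
  \<open>q - l\<close>. Multiplication by the trapezoid thus becomes a twisted convolution in
  \<open>q\<close>.\<close>

lemma zak_cutoff:
  assumes n: "n > 0"
  shows "zak n (cutoff (n\<^sup>2) m f) p q
    = (\<Sum>l\<in>{0..<n\<^sup>2}. smoother (n\<^sup>2) m l * ee (of_int (p * l) / of_int (n\<^sup>2)) * zak n f p (q - l))"
proof -
  let ?d = "n\<^sup>2"
  have e: "ee (of_int ((p - j * n) * l) / of_int ?d) * ee (of_int (j * q) / of_int n)
      = ee (of_int (p * l) / of_int ?d) * ee (of_int (j * (q - l)) / of_int n)" for j l
  proof -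
    have "of_int ((p - j * n) * l) / of_int ?d + of_int (j * q) / of_int n
        = of_int (p * l) / of_int ?d + (of_int (j * (q - l)) / of_int n :: real)"
      using n by (simp add: field_simps power2_eq_square)
    then show ?thesis
      by (simp only: ee_add[symmetric])
  qed
  have "zak n (cutoff ?d m f) p q = (\<Sum>j\<in>{0..<n}. \<Sum>l\<in>{0..<?d}. smoother ?d m l * f (p - j * n) *
      (ee (of_int ((p - j * n) * l) / of_int ?d) * ee (of_int (j * q) / of_int n)))"
    unfolding zak_def cutoff_def trapezoid_def sum_distrib_right
    by (intro sum.cong refl) (simp only: mult_ac)
  also have "\<dots> = (\<Sum>l\<in>{0..<?d}. \<Sum>j\<in>{0..<n}. smoother ?d m l * f (p - j * n) *
      (ee (of_int (p * l) / of_int ?d) * ee (of_int (j * (q - l)) / of_int n)))"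
    unfolding e by (rule sum.swap)
  also have "\<dots> = (\<Sum>l\<in>{0..<?d}. smoother ?d m l * ee (of_int (p * l) / of_int ?d) * zak n f p (q - l))"
    unfolding zak_def sum_distrib_left by (intro sum.cong refl) (simp only: mult_ac)
  finally show ?thesis .
qed

text \<open>Re-indexing the convolution moves the shift from \<open>p\<close> onto the kernel. Since
  the Zak values are unimodular, the \<open>L^1\<close> bound on kernel increments applies
  directly.\<close>

lemma norm_zak_lowpass_diff_le:
  assumes n: "n > 0" and per: "\<And>j. f (j + n\<^sup>2) = f j" and unit: "\<And>p q. cmod (zak n f p q) = 1"
    and m: "m > 0" "2 * m \<le> n\<^sup>2" and h: "0 \<le> h" "16 * h * m \<le> n\<^sup>2"
  shows "cmod (zak n (lowpass (n\<^sup>2) m f) (p + h) q - zak n (lowpass (n\<^sup>2) m f) p q) \<le> 1"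
proof -
  let ?d = "n\<^sup>2" and ?s = "smoother (n\<^sup>2) m"
  have d: "?d > 0"
    using n by simp
  have "?s (l + ?d) * zak n f (p + (l + ?d)) q = ?s l * zak n f (p + l) q" for l
    using zak_periodic_fst[where f = f, OF per, of "p + l" q] smoother_periodic[OF d]
    by (simp add: add.assoc)
  then have "zak n (lowpass ?d m f) p q = (\<Sum>l\<in>{0..<?d}. ?s (l + h) * zak n f (p + (l + h)) q)"
    unfolding zak_lowpass
    by (intro sum_periodic_shift[where f = "\<lambda>l. ?s l * zak n f (p + l) q", symmetric] d)
  then have "zak n (lowpass ?d m f) (p + h) q - zak n (lowpass ?d m f) p q
      = - (\<Sum>l\<in>{0..<?d}. (?s (l + h) - ?s l) * zak n f (p + (l + h)) q)"
    unfolding zak_lowpass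
    by (simp add: sum_subtractf[symmetric] sum_negf[symmetric] algebra_simps)
  then have "cmod (zak n (lowpass ?d m f) (p + h) q - zak n (lowpass ?d m f) p q)
      \<le> (\<Sum>l\<in>{0..<?d}. cmod ((?s (l + h) - ?s l) * zak n f (p + (l + h)) q))"
    by (simp only: norm_minus_cancel norm_sum)
  also have "\<dots> \<le> 1"
    using sum_norm_smoother_diff_le[OF d m h] by (simp add: norm_mult unit)
  finally show ?thesis .
qed

text \<open>The same re-indexing in \<open>q\<close>, where the characters of the twisted
  convolution leave behind the phase \<open>ee (p * h / n^2)\<close>. This is the connection used in
  \<open>no_almost_parallel_section\<close>.\<close>

lemma norm_zak_cutoff_diff_le:
  assumes n: "n > 0" and unit: "\<And>p q. cmod (zak n f p q) = 1"
    and m: "m > 0" "2 * m \<le> n\<^sup>2" and h: "0 \<le> h" "16 * h * m \<le> n\<^sup>2"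
  shows "cmod (zak n (cutoff (n\<^sup>2) m f) p (q + h)
      - ee (of_int (p * h) / of_int (n\<^sup>2)) * zak n (cutoff (n\<^sup>2) m f) p q) \<le> 1"
proof -
  let ?d = "n\<^sup>2" and ?s = "smoother (n\<^sup>2) m"
  let ?e = "\<lambda>k. ee (of_int k / of_int (n\<^sup>2))"
  have d: "?d > 0"
    using n by simp
  have e: "?e (p * (l + h)) = ?e (p * h) * ?e (p * l)" for l
    by (simp add: ee_add[symmetric] add_divide_distrib[symmetric] algebra_simps)
  have "?s (l + ?d) * ?e (p * (l + ?d)) * zak n f p (q + h - (l + ?d))
      = ?s l * ?e (p * l) * zak n f p (q + h - l)" for l
    using zak_periodic_snd[OF n, of f p "q + h - l" "- n"] smoother_periodic[OF d, of m l]
      ee_shift_period[OF d, of p l 1]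
    by (simp add: power2_eq_square algebra_simps)
  then have "zak n (cutoff ?d m f) p (q + h)
      = (\<Sum>l\<in>{0..<?d}. ?s (l + h) * ?e (p * (l + h)) * zak n f p (q + h - (l + h)))"
    unfolding zak_cutoff[OF n]
    by (intro sum_periodic_shift[where f = "\<lambda>l. ?s l * ?e (p * l) * zak n f p (q + h - l)", symmetric] d)
  also have "\<dots> = (\<Sum>l\<in>{0..<?d}. ?s (l + h) * (?e (p * h) * ?e (p * l)) * zak n f p (q - l))"
    unfolding e by simp
  finally have 1: "zak n (cutoff ?d m f) p (q + h)
      = (\<Sum>l\<in>{0..<?d}. ?s (l + h) * (?e (p * h) * ?e (p * l)) * zak n f p (q - l))" .
  have 2: "?e (p * h) * zak n (cutoff ?d m f) p q
      = (\<Sum>l\<in>{0..<?d}. ?e (p * h) * (?s l * ?e (p * l) * zak n f p (q - l)))"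
    unfolding zak_cutoff[OF n] sum_distrib_left ..
  have "zak n (cutoff ?d m f) p (q + h) - ?e (p * h) * zak n (cutoff ?d m f) p q
      = (\<Sum>l\<in>{0..<?d}. (?s (l + h) - ?s l) * (?e (p * h) * ?e (p * l) * zak n f p (q - l)))"
    unfolding 1 2 sum_subtractf[symmetric]
  proof (rule sum.cong[OF refl])
    fix l
    have "a * (c * e) * z - c * (b * e * z) = (a - b) * (c * e * z)" for a b c e z :: complex
      by (simp add: algebra_simps)
    then show "?s (l + h) * (?e (p * h) * ?e (p * l)) * zak n f p (q - l)
          - ?e (p * h) * (?s l * ?e (p * l) * zak n f p (q - l))
        = (?s (l + h) - ?s l) * (?e (p * h) * ?e (p * l) * zak n f p (q - l))" .
  qed
  then have "cmod (zak n (cutoff ?d m f) p (q + h) - ?e (p * h) * zak n (cutoff ?d m f) p q)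
      \<le> (\<Sum>l\<in>{0..<?d}. cmod ((?s (l + h) - ?s l) * (?e (p * h) * ?e (p * l) * zak n f p (q - l))))"
    by (simp only: norm_sum)
  also have "\<dots> \<le> 1"
    using sum_norm_smoother_diff_le[OF d m h] by (simp add: norm_mult unit)
  finally show ?thesis .
qed

section \<open>The discrete Fourier transform\<close>

lemma interval_eq: "{a..b - 1} = {a..<b}" for a b :: int
  by auto

lemma fourier_eq:
  "fourier N f k = (\<Sum>j\<in>{0..<(int N)\<^sup>2}. f j * ee (of_int (- (j * k)) / of_int ((int N)\<^sup>2))) / of_nat N"
proof -
  have "exp (- 2 * pi * \<i> * of_int j * of_int k / of_nat (N\<^sup>2)) = ee (of_int (- (j * k)) / of_int ((int N)\<^sup>2))" for j
    by (simp add: ee_def cis_conv_exp mult_ac)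
  then show ?thesis
    by (simp add: fourier_def interval_eq)
qed

lemma fourier_diff: "fourier N (\<lambda>j. f j - g j) k = fourier N f k - fourier N g k"
  by (simp add: fourier_eq sum_subtractf left_diff_distrib diff_divide_distrib)

lemma fourier_sum_sq:
  assumes "N > 0"
  shows "(\<Sum>k\<in>{0..<(int N)\<^sup>2}. (cmod (fourier N f k))\<^sup>2) = (\<Sum>j\<in>{0..<(int N)\<^sup>2}. (cmod (f j))\<^sup>2)"
proof -
  let ?d = "(int N)\<^sup>2"
  \<comment> \<open>Conjugation preserves the modulus and reverses the sign in the exponent to the
    one in \<open>parseval_sum\<close>.\<close>
  have "(cmod (fourier N f k))\<^sup>2 =
      (cmod (\<Sum>j\<in>{0..<?d}. cnj (f j) * ee (of_int (j * k) / of_int ?d)))\<^sup>2 / (real N)\<^sup>2" for k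
  proof -
    have "cnj (\<Sum>j\<in>{0..<?d}. f j * ee (of_int (- (j * k)) / of_int ?d))
        = (\<Sum>j\<in>{0..<?d}. cnj (f j) * ee (of_int (j * k) / of_int ?d))"
      by (simp add: cnj_ee)
    from arg_cong[OF this, of cmod]
    have "cmod (\<Sum>j\<in>{0..<?d}. f j * ee (of_int (- (j * k)) / of_int ?d))
        = cmod (\<Sum>j\<in>{0..<?d}. cnj (f j) * ee (of_int (j * k) / of_int ?d))"
      by (simp only: complex_mod_cnj)
    then show ?thesis
      unfolding fourier_eq norm_divide power_divide by simp
  qed
  then have "(\<Sum>k\<in>{0..<?d}. (cmod (fourier N f k))\<^sup>2) =
      (\<Sum>k\<in>{0..<?d}. (cmod (\<Sum>j\<in>{0..<?d}. cnj (f j) * ee (of_int (j * k) / of_int ?d)))\<^sup>2) / (real N)\<^sup>2"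
    by (simp only: sum_divide_distrib)
  also have "\<dots> = (\<Sum>j\<in>{0..<?d}. (cmod (f j))\<^sup>2)"
    using assms by (subst parseval_sum) simp_all
  finally show ?thesis .
qed

lemma fourier_translate:
  assumes "N > 0" and per: "\<And>j. f (j + (int N)\<^sup>2) = f j"
  shows "fourier N (\<lambda>j. f (j + l)) k = ee (of_int (k * l) / of_int ((int N)\<^sup>2)) * fourier N f k"
proof -
  let ?d = "(int N)\<^sup>2"
  let ?e = "\<lambda>j. ee (of_int j / of_int ?d)"
  have d: "?d > 0"
    using assms by simp
  have e: "?e (- (j * k)) = ?e (k * l) * ?e (- ((j + l) * k))" for j
  proof -
    have "- (j * k) = k * l + - ((j + l) * k)"
      by (simp add: algebra_simps)
    then show ?thesis
      by (simp only: ee_mult_int)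
  qed
  have "(\<Sum>j\<in>{0..<?d}. f (j + l) * ?e (- (j * k)))
      = ?e (k * l) * (\<Sum>j\<in>{0..<?d}. f (j + l) * ?e (- ((j + l) * k)))"
    unfolding sum_distrib_left
  proof (rule sum.cong[OF refl])
    fix j
    show "f (j + l) * ?e (- (j * k)) = ?e (k * l) * (f (j + l) * ?e (- ((j + l) * k)))"
      unfolding e[of j] by (simp only: mult_ac)
  qed
  also have "(\<Sum>j\<in>{0..<?d}. f (j + l) * ?e (- ((j + l) * k))) = (\<Sum>j\<in>{0..<?d}. f j * ?e (- (j * k)))"
  proof (rule sum_periodic_shift[where f = "\<lambda>j. f j * ?e (- (j * k))", OF d])
    fix j
    have "- ((j + ?d) * k) = - k * (j + 1 * ?d)" "- (j * k) = - k * j"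
      by (simp_all add: algebra_simps)
    then show "f (j + ?d) * ?e (- ((j + ?d) * k)) = f j * ?e (- (j * k))"
      by (simp only: per ee_shift_period[OF d])
  qed
  finally show ?thesis
    by (simp add: fourier_eq)
qed

text \<open>The convolution theorem: a translate by \<open>l\<close> becomes a character in
  \<open>k\<close>, and summing these against the kernel rebuilds the trapezoid.\<close>

lemma fourier_lowpass:
  assumes "N > 0" and "\<And>j. f (j + (int N)\<^sup>2) = f j"
  shows "fourier N (lowpass ((int N)\<^sup>2) m f) k = trapezoid ((int N)\<^sup>2) m k * fourier N f k"
proof -
  let ?d = "(int N)\<^sup>2"
  let ?e = "\<lambda>j. ee (of_int (- (j * k)) / of_int ?d)"
  have "fourier N (lowpass ?d m f) k
      = (\<Sum>j\<in>{0..<?d}. \<Sum>l\<in>{0..<?d}. smoother ?d m l * (f (j + l) * ?e j / of_nat N))"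
    unfolding fourier_eq lowpass_def sum_divide_distrib sum_distrib_right
    by (simp only: times_divide_eq_right mult.assoc)
  also have "\<dots> = (\<Sum>l\<in>{0..<?d}. \<Sum>j\<in>{0..<?d}. smoother ?d m l * (f (j + l) * ?e j / of_nat N))"
    by (rule sum.swap)
  also have "\<dots> = (\<Sum>l\<in>{0..<?d}. smoother ?d m l * fourier N (\<lambda>j. f (j + l)) k)"
    by (simp only: sum_distrib_left[symmetric] sum_divide_distrib[symmetric] fourier_eq)
  also have "\<dots> = trapezoid ?d m k * fourier N f k"
    unfolding fourier_translate[where f = f, OF assms] trapezoid_def sum_distrib_right by (simp only: mult.assoc)
  finally show ?thesis .
qed

text \<open>The error vanishes below \<open>m\<close>, where the trapezoid is 1, and is dominated by
  \<open>f\<close> elsewhere. It serves on the time side for the cutoff and on the frequency side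
  for the filter.\<close>

lemma sum_sq_trapezoid_error_le:
  fixes f :: "int \<Rightarrow> complex"
  assumes "m > 0" "2 * m \<le> d"
  shows "(\<Sum>j\<in>{0..<d}. (cmod (f j - trapezoid d m j * f j))\<^sup>2) \<le> (\<Sum>j\<in>{m..<d}. (cmod (f j))\<^sup>2)"
proof -
  have d: "d > 0"
    using assms by simp
  have "cmod (f j - trapezoid d m j * f j) = cmod (1 - trapezoid d m j) * cmod (f j)" for j
    by (simp add: norm_mult[symmetric] left_diff_distrib)
  moreover have "cmod (1 - trapezoid d m j) * cmod (f j) \<le> 1 * cmod (f j)" for j
    using norm_1_minus_trapezoid_le[OF d assms] by (intro mult_right_mono) auto
  ultimately have le: "(cmod (f j - trapezoid d m j * f j))\<^sup>2 \<le> (cmod (f j))\<^sup>2" for j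
    by (intro power_mono) auto
  have "(\<Sum>j\<in>{0..<d}. (cmod (f j - trapezoid d m j * f j))\<^sup>2)
      = (\<Sum>j\<in>{m..<d}. (cmod (f j - trapezoid d m j * f j))\<^sup>2)"
    using assms trapezoid_eq_1[OF d assms] by (intro sum.mono_neutral_right) auto
  also have "\<dots> \<le> (\<Sum>j\<in>{m..<d}. (cmod (f j))\<^sup>2)"
    by (intro sum_mono le)
  finally show ?thesis .
qed

section \<open>The uncertainty estimate\<close>

lemma mesh_bounds:
  fixes n r :: int
  assumes "r \<ge> 1" "16 * r \<le> n"
  defines "k \<equiv> n div (16 * r)"
  shows "k > 0" "16 * (k * r) \<le> n" "of_int (n div k + 1) \<le> (64 * of_int r :: real)"
proof -
  show k: "k > 0"
    using assms by (simp add: pos_imp_zdiv_pos_iff)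
  have div: "n = k * (16 * r) + n mod (16 * r)"
    unfolding k_def by (rule div_mult_mod_eq[symmetric])
  moreover have "0 \<le> n mod (16 * r)" "n mod (16 * r) < 16 * r"
    using assms by auto
  ultimately show "16 * (k * r) \<le> n"
    by (simp add: mult_ac)
  \<comment> \<open>As \<open>k \<ge> 1\<close>, the remainder is below \<open>16 * r * k\<close>,
    so rounding down costs at most a factor 2 in the mesh.\<close>
  have "1 * (16 * r) \<le> k * (16 * r)"
    using k assms by (intro mult_right_mono) auto
  then have "n < k * (32 * r)"
    using div \<open>n mod (16 * r) < 16 * r\<close> by linarith
  moreover have "n div k * k \<le> n"
    using div_mult_mod_eq[of n k] pos_mod_sign[OF k, of n] by linarith
  ultimately have "n div k * k < 32 * r * k"
    by (simp add: mult_ac)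
  then have "n div k < 32 * r"
    using k by (simp add: mult_less_cancel_right)
  then have "n div k + 1 \<le> 64 * r"
    using assms by linarith
  then show "of_int (n div k + 1) \<le> (64 * of_int r :: real)"
    by (metis of_int_le_iff of_int_mult of_int_numeral)
qed

text \<open>The constant is \<open>262144 = 64^3\<close>: one factor is the error threshold of a
  grid, the other two come from the numbers of grid steps, at most \<open>64 * R\<close> and
  \<open>64 * Q\<close>.\<close>

lemma uncertainty_of_unimodular_zak:
  fixes N Q R :: nat and f :: "int \<Rightarrow> complex"
  assumes N: "N > 0" and per: "\<And>j. f (j + (int N)\<^sup>2) = f j"
    and unit: "\<And>p q. cmod (zak (int N) f p q) = 1"
    and Q: "Q \<ge> 1" "16 * Q \<le> N" and R: "R \<ge> 1" "16 * R \<le> N"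
  shows "1 / 262144 / (real Q * real R) \<le>
    1 / real N * (\<Sum>j\<in>{int (N * Q)..<(int N)\<^sup>2}. (cmod (f j))\<^sup>2)
    + 1 / real N * (\<Sum>k\<in>{int (N * R)..<(int N)\<^sup>2}. (cmod (fourier N f k))\<^sup>2)"
proof -
  define n where "n = int N"
  define mQ where "mQ = n * int Q"
  define mR where "mR = n * int R"
  define g where "g = lowpass (n\<^sup>2) mR f"
  define h where "h = cutoff (n\<^sup>2) mQ f"
  \<comment> \<open>With filter length \<open>n * R\<close> the increment condition
    \<open>16 * h * m \<le> n^2\<close> becomes \<open>16 * h * R \<le> n\<close>, which fixes the
    horizontal mesh. The cutoff at \<open>n * Q\<close> fixes the vertical one likewise.\<close>
  define k where "k = n div (16 * int R)"
  define l where "l = n div (16 * int Q)"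
  have n: "n > 0"
    using N by (simp add: n_def)
  have d: "n\<^sup>2 > 0"
    using n by simp
  have k: "k > 0" "16 * (k * int R) \<le> n" "of_int (n div k + 1) \<le> 64 * real R"
    using mesh_bounds[of "int R" n] R by (simp_all add: k_def n_def)
  have l: "l > 0" "16 * (l * int Q) \<le> n" "of_int (n div l + 1) \<le> 64 * real Q"
    using mesh_bounds[of "int Q" n] Q by (simp_all add: l_def n_def)
  have m: "mR > 0" "2 * mR \<le> n\<^sup>2" "mQ > 0" "2 * mQ \<le> n\<^sup>2"
    using N Q R by (simp_all add: mQ_def mR_def n_def power2_eq_square)
  have small: "16 * u * (n * v) \<le> n\<^sup>2" if "u \<le> w" "16 * (w * v) \<le> n" "v \<ge> 0" for u v w :: int
  proof -
    have "u * v \<le> w * v"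
      using that by (intro mult_right_mono) auto
    then have "n * (16 * (u * v)) \<le> n * n"
      using n that by (intro mult_left_mono) auto
    then show ?thesis
      by (simp add: power2_eq_square mult_ac)
  qed
  have per_n: "f (j + n\<^sup>2) = f j" for j
    using per by (simp add: n_def)
  have unit_n: "cmod (zak n f p q) = 1" for p q
    using unit by (simp add: n_def)
  have g_per: "g (j + n\<^sup>2) = g j" for j
    unfolding g_def lowpass_def
    by (intro sum.cong refl) (metis per_n add.assoc add.commute)
  have trapezoid_per: "trapezoid (n\<^sup>2) mQ (j + n\<^sup>2) = trapezoid (n\<^sup>2) mQ j" for j
    unfolding trapezoid_def
  proof (rule sum.cong[OF refl])
    fix i
    show "smoother (n\<^sup>2) mQ i * ee (of_int ((j + n\<^sup>2) * i) / of_int (n\<^sup>2))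
        = smoother (n\<^sup>2) mQ i * ee (of_int (j * i) / of_int (n\<^sup>2))"
      using ee_shift_period[OF d, of i j 1] by (simp add: mult_ac)
  qed
  have h_per: "h (j + n\<^sup>2) = h j" for j
    by (simp add: h_def cutoff_def trapezoid_per per_n)
  define E where "E p q = (cmod (zak n f p q - zak n g p q))\<^sup>2 + (cmod (zak n f p q - zak n h p q))\<^sup>2" for p q
  have quasi: "zak n u (p + n) q = ee (of_int q / of_int n) * zak n u p q"
    if "\<And>j. u (j + n\<^sup>2) = u j" for u p q
    by (rule zak_quasiperiodic[where f = u, OF n that])
  have snd: "zak n u p (q + n) = zak n u p q" for u p q
    using zak_periodic_snd[OF n, of u p q 1] by simp
  have E1: "E (p + n) q = E p q" for p q
    unfolding E_def
    by (simp add: quasi per_n g_per h_per right_diff_distrib[symmetric] norm_mult)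
  have E2: "E p (q + n) = E p q" for p q
    unfolding E_def by (simp add: snd)
  define S where "S = (\<Sum>p\<in>{0..<n}. \<Sum>q\<in>{0..<n}. E p q)"
  have "256 * (k * l) \<le> n\<^sup>2"
  proof -
    have "k * 1 \<le> k * int R" "l * 1 \<le> l * int Q"
      using k l Q R by (intro mult_left_mono; simp)+
    then have "16 * k \<le> n" "16 * l \<le> n"
      using k l by linarith+
    then have "(16 * k) * (16 * l) \<le> n * n"
      using k l n by (intro mult_mono) auto
    then show ?thesis
      by (simp add: power2_eq_square)
  qed
  then have "(of_int n)\<^sup>2 \<le> 64 * of_int (n div k + 1) * of_int (n div l + 1) * S"
    unfolding S_def E_def
  proof (intro sum_smoothing_error_ge[where Z = "zak n f"] n unit_n quasi per_n snd
      E1[unfolded E_def] E2[unfolded E_def] k l)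
    fix p q t assume t: "0 \<le> t" "t \<le> k"
    show "cmod (zak n g (p + t) q - zak n g p q) \<le> 1"
      unfolding g_def using small[OF t(2) k(2)] m t(1)
      by (intro norm_zak_lowpass_diff_le n per_n unit_n) (simp_all add: mR_def)
  next
    fix p q t assume t: "0 \<le> t" "t \<le> l"
    show "cmod (zak n h p (q + t) - ee (of_int (p * t) / of_int (n\<^sup>2)) * zak n h p q) \<le> 1"
      unfolding h_def using small[OF t(2) l(2)] m t(1)
      by (intro norm_zak_cutoff_diff_le n unit_n) (simp_all add: mQ_def)
  qed
  also have "\<dots> \<le> 64 * (64 * real R) * (64 * real Q) * S"
  proof -
    have "S \<ge> 0"
      unfolding S_def E_def by (intro sum_nonneg) auto
    moreover have "n div k \<ge> 0" "n div l \<ge> 0"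
      using n k l by (simp_all add: pos_imp_zdiv_nonneg_iff)
    ultimately show ?thesis
      using k(3) l(3) by (intro mult_right_mono mult_mono) auto
  qed
  finally have lower: "(of_int n)\<^sup>2 \<le> 262144 * (real Q * real R) * S"
    by (simp add: mult_ac)
  define tail_Q where "tail_Q = (\<Sum>j\<in>{mQ..<n\<^sup>2}. (cmod (f j))\<^sup>2)"
  define tail_R where "tail_R = (\<Sum>j\<in>{mR..<n\<^sup>2}. (cmod (fourier N f j))\<^sup>2)"
  \<comment> \<open>The Zak transform carries both errors back to the time side at the cost of a
    factor \<open>n\<close>. The error of the filter then moves on to the frequency side by
    Parseval.\<close>
  have "S = of_int n * ((\<Sum>j\<in>{0..<n\<^sup>2}. (cmod (f j - g j))\<^sup>2) + (\<Sum>j\<in>{0..<n\<^sup>2}. (cmod (f j - h j))\<^sup>2))"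
    unfolding S_def E_def sum.distrib distrib_left zak_diff[symmetric]
    by (subst (1 2) zak_sum_sq) (simp_all add: n per_n g_per h_per)
  also have "\<dots> \<le> of_int n * (tail_R + tail_Q)"
  proof (intro mult_left_mono add_mono)
    have "(\<Sum>j\<in>{0..<n\<^sup>2}. (cmod (f j - g j))\<^sup>2) = (\<Sum>j\<in>{0..<n\<^sup>2}. (cmod (fourier N (\<lambda>j. f j - g j) j))\<^sup>2)"
      using fourier_sum_sq[OF N, of "\<lambda>j. f j - g j"] by (simp add: n_def)
    also have "\<dots> = (\<Sum>j\<in>{0..<n\<^sup>2}. (cmod (fourier N f j - trapezoid (n\<^sup>2) mR j * fourier N f j))\<^sup>2)"
      using fourier_lowpass[where f = f, OF N per, of mR] by (simp add: fourier_diff g_def n_def)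
    also have "\<dots> \<le> tail_R"
      unfolding tail_R_def by (rule sum_sq_trapezoid_error_le[OF m(1,2)])
    finally show "(\<Sum>j\<in>{0..<n\<^sup>2}. (cmod (f j - g j))\<^sup>2) \<le> tail_R" .
    show "(\<Sum>j\<in>{0..<n\<^sup>2}. (cmod (f j - h j))\<^sup>2) \<le> tail_Q"
      unfolding tail_Q_def h_def cutoff_def by (rule sum_sq_trapezoid_error_le[OF m(3,4)])
  qed (use n in simp)
  finally have "262144 * (real Q * real R) * S \<le> 262144 * (real Q * real R) * (of_int n * (tail_R + tail_Q))"
    by (intro mult_left_mono) auto
  with lower have "of_int n * of_int n \<le> 262144 * (real Q * real R) * (of_int n * (tail_R + tail_Q))"
    by (simp add: power2_eq_square)
  then have "real N * real N \<le> real N * (262144 * (real Q * real R) * (tail_R + tail_Q))"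
    by (simp add: n_def mult_ac)
  then have "real N \<le> 262144 * (real Q * real R) * (tail_R + tail_Q)"
    using N by simp
  then have "1 / 262144 / (real Q * real R) \<le> 1 / real N * tail_Q + 1 / real N * tail_R"
    using N Q R by (simp add: field_simps)
  then show ?thesis
    by (simp add: tail_Q_def tail_R_def mQ_def mR_def n_def)
qed

text \<open>Pairing the element of index \<open>(N * s, N * t)\<close> with \<open>b\<close>, the
  element of index \<open>(0, 0)\<close>, gives the relations required by
  \<open>norm_zak_eq_1\<close>: modulation by \<open>N * t\<close> modulo \<open>N^2\<close> is the
  character of frequency \<open>t\<close> modulo \<open>N\<close>.\<close>

lemma norm_zak_of_gabor_basis:
  assumes N: "N > 0" and b: "b \<in> ell2 N"
    and onb: "orthonormal_basis N (NZd N \<times> NZd N) (gabor N b)"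
  shows "cmod (zak (int N) b p q) = 1"
proof (rule norm_zak_eq_1)
  show "int N > 0"
    using N by simp
  show "b (j + (int N)\<^sup>2) = b j" for j
    using b by (simp add: ell2_def)
  have mem: "int N * s \<in> NZd N" if "s \<in> {0..<int N}" for s
  proof -
    have "int N * s < int N * int N"
      using that N by (intro mult_strict_left_mono) auto
    then have "(int N * s) mod int (N\<^sup>2) = int N * s"
      using that by (simp add: power2_eq_square)
    then show ?thesis
      unfolding NZd_def by (metis (mono_tags, lifting) mem_Collect_eq)
  qed
  fix s t assume s: "s \<in> {0..<int N}" and t: "t \<in> {0..<int N}"
  have "ell2_inner N (gabor N b (int N * s, int N * t)) (gabor N b (0, 0))
      = (if s = 0 \<and> t = 0 then 1 else 0)"
    using onb mem[OF s] mem[OF t] mem[of 0] N unfolding orthonormal_basis_def by auto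
  moreover have "exp (2 * pi * \<i> * of_int (int N * t) * of_int j / of_nat (N\<^sup>2)) = ee (of_int (t * j) / of_int (int N))" for j
    using N by (simp add: ee_def cis_conv_exp power2_eq_square mult_ac)
  ultimately have "(\<Sum>j\<in>{0..<(int N)\<^sup>2}. ee (of_int (t * j) / of_int (int N)) * b (j - int N * s) * cnj (b j))
      / of_nat N = (if s = 0 \<and> t = 0 then 1 else 0)"
    unfolding ell2_inner_def gabor_def by (simp add: interval_eq)
  then have "(\<Sum>j\<in>{0..<(int N)\<^sup>2}. ee (of_int (t * j) / of_int (int N)) * b (j - int N * s) * cnj (b j))
      = (if s = 0 \<and> t = 0 then 1 else 0) * of_nat N"
    using N by (simp only: divide_eq_eq of_nat_eq_0_iff split: if_split)
  then show "(\<Sum>j\<in>{0..<(int N)\<^sup>2}. ee (of_int (t * j) / of_int (int N)) * b (j - s * int N) * cnj (b j))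
      = (if s = 0 \<and> t = 0 then of_int (int N) else 0)"
    unfolding mult.commute[of s "int N"] by (simp only: of_int_of_nat_eq) simp
qed

theorem theorem1p5:
  "\<exists>C::real. C > 0 \<and>
     (\<forall>(N::nat) (d::nat) (b::int \<Rightarrow> complex).
        N \<ge> 200 \<longrightarrow> d = N\<^sup>2 \<longrightarrow> b \<in> ell2 N \<longrightarrow>
        orthonormal_basis N (NZd N \<times> NZd N) (gabor N b) \<longrightarrow>
        (\<forall>(Q::nat) (R::nat).
           1 \<le> Q \<longrightarrow> real Q \<le> real N / 16 \<longrightarrow> 1 \<le> R \<longrightarrow> real R \<le> real N / 16 \<longrightarrow>
           1 / real N * (\<Sum>j = int (N * Q)..int d - 1. (cmod (b j))\<^sup>2)
           + 1 / real N * (\<Sum>k = int (N * R)..int d - 1. (cmod (fourier N b k))\<^sup>2)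
           \<ge> C / (real Q * real R)))"
proof (intro exI[of _ "1 / 262144"] conjI allI impI)
  fix N d :: nat and b :: "int \<Rightarrow> complex" and Q R :: nat
  assume *: "N \<ge> 200" "d = N\<^sup>2" "b \<in> ell2 N"
    "orthonormal_basis N (NZd N \<times> NZd N) (gabor N b)"
    "1 \<le> Q" "real Q \<le> real N / 16" "1 \<le> R" "real R \<le> real N / 16"
  then have N: "N > 0"
    by simp
  have "b (j + (int N)\<^sup>2) = b j" for j
    using *(3) by (simp add: ell2_def)
  moreover have "16 * Q \<le> N" "16 * R \<le> N"
    using *(6,8) by linarith+
  ultimately show "1 / 262144 / (real Q * real R)
      \<le> 1 / real N * (\<Sum>j = int (N * Q)..int d - 1. (cmod (b j))\<^sup>2)
        + 1 / real N * (\<Sum>k = int (N * R)..int d - 1. (cmod (fourier N b k))\<^sup>2)"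
    using uncertainty_of_unimodular_zak[OF N _ norm_zak_of_gabor_basis[OF N *(3,4)], of Q R] *(2,5,7)
    by (simp add: interval_eq)
qed simp

end
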